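(* Let $n\in\mathbb{N}$. The involution monoid $(\mathsf{styl}_n,{}^* )$ is finitely based if and only if $n=1$.
   Context: $\mathbb{N}=\{1,2,3,\dots\}$ and $\mathcal{A}_n=\{1<2<\cdots<n\}$. The stylic monoid of rank $n$, $\mathsf{styl}_n$, is the monoid presented by generators $\mathcal{A}_n$ and relations $acb=cab$ (for $a\le b<c$), $bac=bca$ (for $a<b\le c$), and $a^2=a$ (for $a\in\mathcal{A}_n$). An involution on a monoid is a unary operation $^*$ with $(x^* )^*=x$ and $(xy)^*=y^*x^*$; an involution monoid is a monoid together with an involution. The involution $^*$ on $\mathsf{styl}_n$ is the anti-automorphism induced by the order-reversing permutation $x\mapsto n+1-x$ of $\mathcal{A}_n$ (so the class of $a_1\cdots a_k$ is sent to the class of $(n+1-a_k)\cdots(n+1-a_1)$). Involution monoid identities are formal equalities $u\approx v$ of terms in the signature of monoids with a unary operation $^*$; $(M,{}^* )$ satisfies $u\approx v$ if both sides agree under every evaluation of the variables in $M$. An involution monoid is finitely based if there is a finite set of identities satisfied by it from which every identity it satisfies follows (i.e. each identity it satisfies holds in all involution monoids satisfying the finite set). *)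

theory Defs
  imports "HOL-Algebra.Group" "HOL-Library.Countable_Set"
begin

section \<open>Involution monoids and their identities\<close>

locale involution_monoid = monoid G for G (structure) +
  fixes star :: "'a \<Rightarrow> 'a"
  assumes star_closed: "x \<in> carrier G \<Longrightarrow> star x \<in> carrier G"
    and star_star: "x \<in> carrier G \<Longrightarrow> star (star x) = x"
    and star_mult: "\<lbrakk>x \<in> carrier G; y \<in> carrier G\<rbrakk> \<Longrightarrow> star (x \<otimes> y) = star y \<otimes> star x"

datatype iterm = Var nat | One | Times iterm iterm | Star iterm

instance iterm :: countable
  by countable_datatype

type_synonym identity = "iterm \<times> iterm"

primrec eval :: "('a, 'm) monoid_scheme \<Rightarrow> ('a \<Rightarrow> 'a) \<Rightarrow> (nat \<Rightarrow> 'a) \<Rightarrow> iterm \<Rightarrow> 'a" where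
  "eval G s f (Var i) = f i"
| "eval G s f One = \<one>\<^bsub>G\<^esub>"
| "eval G s f (Times u v) = eval G s f u \<otimes>\<^bsub>G\<^esub> eval G s f v"
| "eval G s f (Star u) = s (eval G s f u)"

definition satisfies :: "('a, 'm) monoid_scheme \<Rightarrow> ('a \<Rightarrow> 'a) \<Rightarrow> identity \<Rightarrow> bool" where
  "satisfies G s e \<longleftrightarrow>
     (\<forall>f. (\<forall>i. f i \<in> carrier G) \<longrightarrow> eval G s f (fst e) = eval G s f (snd e))"

text \<open>
  A definition cannot quantify over all types, so the involution monoids below are those whose
  carrier is a set of natural numbers. Nothing is lost: lemma \<open>follows_from_any\<close> shows that
  an identity following from \<open>E\<close> in this sense holds in every involution monoid, over any type,
  that satisfies \<open>E\<close>.
\<close>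

definition follows_from :: "identity set \<Rightarrow> identity \<Rightarrow> bool" where
  "follows_from E e \<longleftrightarrow>
     (\<forall>(H :: nat monoid) t. involution_monoid H t \<and> (\<forall>d\<in>E. satisfies H t d) \<longrightarrow> satisfies H t e)"

definition finitely_based :: "('a, 'm) monoid_scheme \<Rightarrow> ('a \<Rightarrow> 'a) \<Rightarrow> bool" where
  "finitely_based G s \<longleftrightarrow>
     (\<exists>E. finite E \<and> (\<forall>e\<in>E. satisfies G s e) \<and> (\<forall>e. satisfies G s e \<longrightarrow> follows_from E e))"

lemma (in involution_monoid) eval_closed:
  assumes "\<And>i. f i \<in> carrier G"
  shows "eval G star f w \<in> carrier G"
  by (induction w) (auto simp: assms star_closed)

text \<open>
  If an identity fails in \<open>G\<close> under the assignment \<open>f\<close>, it fails in the countable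
  sub-involution-monoid generated by the values of \<open>f\<close>, which has a copy on a set of naturals.
\<close>

lemma follows_from_any:
  fixes G :: "('a, 'm) monoid_scheme"
  assumes fol: "follows_from E e"
    and G: "involution_monoid G s"
    and E: "\<And>d. d \<in> E \<Longrightarrow> satisfies G s d"
  shows "satisfies G s e"
  unfolding satisfies_def
proof (intro allI impI)
  fix f :: "nat \<Rightarrow> 'a"
  assume "\<forall>i. f i \<in> carrier G"
  then have f: "\<And>i. f i \<in> carrier G" by blast
  interpret involution_monoid G s by (fact G)
  define C where "C = range (eval G s f)"
  have cC: "countable C" unfolding C_def by simp
  have CG: "x \<in> carrier G" if "x \<in> C" for x
    using that f eval_closed unfolding C_def by blast
  have C1: "\<one>\<^bsub>G\<^esub> \<in> C" unfolding C_def by (metis eval.simps(2) rangeI)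
  have Cm: "x \<otimes>\<^bsub>G\<^esub> y \<in> C" if "x \<in> C" "y \<in> C" for x y
  proof -
    from that obtain u v where "x = eval G s f u" "y = eval G s f v" unfolding C_def by blast
    then have "x \<otimes>\<^bsub>G\<^esub> y = eval G s f (Times u v)" by simp
    then show ?thesis unfolding C_def by (rule range_eqI)
  qed
  have Cs: "s x \<in> C" if "x \<in> C" for x
  proof -
    from that obtain u where "x = eval G s f u" unfolding C_def by blast
    then have "s x = eval G s f (Star u)" by simp
    then show ?thesis unfolding C_def by (rule range_eqI)
  qed
  have Cf: "f i \<in> C" for i unfolding C_def by (metis eval.simps(1) rangeI)
  define p where "p = to_nat_on C"
  define q where "q = from_nat_into C"
  have qp: "q (p x) = x" if "x \<in> C" for x
    using cC that unfolding p_def q_def by simp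
  define H :: "nat monoid" where
    "H = \<lparr>carrier = p ` C, mult = (\<lambda>x y. p (q x \<otimes>\<^bsub>G\<^esub> q y)), one = p \<one>\<^bsub>G\<^esub>\<rparr>"
  define t where "t = (\<lambda>x. p (s (q x)))"
  have H: "involution_monoid H t"
  proof unfold_locales
    show "t x \<in> carrier H" if "x \<in> carrier H" for x
      using that by (auto simp: H_def t_def qp Cs)
    show "t (t x) = x" if "x \<in> carrier H" for x
      using that by (auto simp: H_def t_def qp Cs CG star_star)
    show "t (x \<otimes>\<^bsub>H\<^esub> y) = t y \<otimes>\<^bsub>H\<^esub> t x" if "x \<in> carrier H" "y \<in> carrier H" for x y
      using that by (auto simp: H_def t_def qp Cs Cm CG star_mult)
  qed (auto simp: H_def qp C1 Cm CG m_assoc)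
  have ev: "eval H t g w = p (eval G s (q \<circ> g) w) \<and> eval G s (q \<circ> g) w \<in> C"
    if g: "\<And>i. g i \<in> p ` C" for g :: "nat \<Rightarrow> nat" and w
  proof (induction w)
    case (Var i)
    from g[of i] show ?case by (auto simp: qp)
  qed (auto simp: H_def t_def qp C1 Cm Cs)
  have "satisfies H t d" if "d \<in> E" for d
    unfolding satisfies_def
  proof (intro allI impI)
    fix g :: "nat \<Rightarrow> nat"
    assume "\<forall>i. g i \<in> carrier H"
    then have g: "\<And>i. g i \<in> p ` C" by (simp add: H_def)
    have "q (g i) \<in> carrier G" for i using g[of i] by (auto simp: qp CG)
    then have "eval G s (q \<circ> g) (fst d) = eval G s (q \<circ> g) (snd d)"
      using E[OF that] unfolding satisfies_def by simp
    then show "eval H t g (fst d) = eval H t g (snd d)" using ev[OF g] by simp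
  qed
  then have "satisfies H t e" using fol H unfolding follows_from_def by blast
  moreover have g: "\<And>i. (p \<circ> f) i \<in> p ` C" by (simp add: Cf)
  ultimately have eq: "eval H t (p \<circ> f) (fst e) = eval H t (p \<circ> f) (snd e)"
    unfolding satisfies_def by (simp add: H_def)
  have qpf: "q \<circ> (p \<circ> f) = f" by (auto simp: qp Cf)
  have evf: "eval H t (p \<circ> f) w = p (eval G s f w)" for w
    using ev[of "p \<circ> f" w] g unfolding qpf by blast
  from eq have "p (eval G s f (fst e)) = p (eval G s f (snd e))"
    unfolding evf .
  then show "eval G s f (fst e) = eval G s f (snd e)"
    by (metis C_def qp rangeI)
qed


section \<open>Monoid presentations\<close>

text \<open>The least congruence containing \<open>R\<close> on the free monoid \<open>lists A\<close>.\<close>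

inductive_set cong_gen :: "'a set \<Rightarrow> ('a list \<times> 'a list) set \<Rightarrow> ('a list \<times> 'a list) set"
  for A R where
  rel: "\<lbrakk>(u, v) \<in> R; u \<in> lists A; v \<in> lists A\<rbrakk> \<Longrightarrow> (u, v) \<in> cong_gen A R"
| refl: "u \<in> lists A \<Longrightarrow> (u, u) \<in> cong_gen A R"
| sym: "(u, v) \<in> cong_gen A R \<Longrightarrow> (v, u) \<in> cong_gen A R"
| trans: "\<lbrakk>(u, v) \<in> cong_gen A R; (v, w) \<in> cong_gen A R\<rbrakk> \<Longrightarrow> (u, w) \<in> cong_gen A R"
| append: "\<lbrakk>(u, v) \<in> cong_gen A R; (u', v') \<in> cong_gen A R\<rbrakk> \<Longrightarrow> (u @ u', v @ v') \<in> cong_gen A R"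

definition presented_monoid :: "'a set \<Rightarrow> ('a list \<times> 'a list) set \<Rightarrow> 'a list set monoid" where
  "presented_monoid A R =
     \<lparr>carrier = lists A // cong_gen A R,
      mult = (\<lambda>X Y. \<Union>x\<in>X. \<Union>y\<in>Y. cong_gen A R `` {x @ y}),
      one = cong_gen A R `` {[]}\<rparr>"

lemma cong_gen_lists: "(u, v) \<in> cong_gen A R \<Longrightarrow> u \<in> lists A \<and> v \<in> lists A"
  by (induction rule: cong_gen.induct) auto

lemma equiv_cong_gen: "equiv (lists A) (cong_gen A R)"
proof (rule equivI)
  show "cong_gen A R \<subseteq> lists A \<times> lists A" by (auto simp del: in_lists_conv_set dest: cong_gen_lists)
  show "refl_on (lists A) (cong_gen A R)" by (rule refl_onI) (rule cong_gen.refl)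
  show "sym (cong_gen A R)" by (rule symI) (rule cong_gen.sym)
  show "trans (cong_gen A R)" by (rule transI) (rule cong_gen.trans)
qed

lemma presented_mult:
  assumes "u \<in> lists A" "v \<in> lists A"
  shows "cong_gen A R `` {u} \<otimes>\<^bsub>presented_monoid A R\<^esub> cong_gen A R `` {v} = cong_gen A R `` {u @ v}"
proof -
  have "congruent2 (cong_gen A R) (cong_gen A R) (\<lambda>x y. cong_gen A R `` {x @ y})"
    by (auto simp: congruent2_def intro!: equiv_class_eq[OF equiv_cong_gen] cong_gen.append)
  from UN_equiv_class2[OF equiv_cong_gen equiv_cong_gen this assms]
  show ?thesis by (simp add: presented_monoid_def)
qed

lemma monoid_presented: "monoid (presented_monoid A R)" (is "monoid ?M")
proof (rule monoidI)
  have c: "carrier ?M = lists A // cong_gen A R" and o: "\<one>\<^bsub>?M\<^esub> = cong_gen A R `` {[]}"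
    by (simp_all add: presented_monoid_def)
  show "x \<otimes>\<^bsub>?M\<^esub> y \<in> carrier ?M" if "x \<in> carrier ?M" "y \<in> carrier ?M" for x y
    using that unfolding c
    by (elim quotientE) (simp only: presented_mult append_in_lists_conv quotientI)
  show "\<one>\<^bsub>?M\<^esub> \<in> carrier ?M" unfolding c o by (auto intro!: quotientI)
  show "x \<otimes>\<^bsub>?M\<^esub> y \<otimes>\<^bsub>?M\<^esub> z = x \<otimes>\<^bsub>?M\<^esub> (y \<otimes>\<^bsub>?M\<^esub> z)"
    if "x \<in> carrier ?M" "y \<in> carrier ?M" "z \<in> carrier ?M" for x y z
    using that unfolding c
    by (elim quotientE) (simp only: presented_mult append_in_lists_conv append_assoc)
  show "\<one>\<^bsub>?M\<^esub> \<otimes>\<^bsub>?M\<^esub> x = x" if "x \<in> carrier ?M" for x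
    using that unfolding c o
    by (elim quotientE) (simp only: presented_mult lists.Nil append_Nil append_Nil2)
  show "x \<otimes>\<^bsub>?M\<^esub> \<one>\<^bsub>?M\<^esub> = x" if "x \<in> carrier ?M" for x
    using that unfolding c o
    by (elim quotientE) (simp only: presented_mult lists.Nil append_Nil append_Nil2)
qed


section \<open>The stylic monoid with its order-reversing involution\<close>

definition styl_rels :: "nat \<Rightarrow> (nat list \<times> nat list) set" where
  "styl_rels n =
     {([a, c, b], [c, a, b]) | a b c. {a, b, c} \<subseteq> {1..n} \<and> a \<le> b \<and> b < c} \<union>
     {([b, a, c], [b, c, a]) | a b c. {a, b, c} \<subseteq> {1..n} \<and> a < b \<and> b \<le> c} \<union>
     {([a, a], [a]) | a. a \<in> {1..n}}"

definition styl_cong :: "nat \<Rightarrow> (nat list \<times> nat list) set" where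
  "styl_cong n = cong_gen {1..n} (styl_rels n)"

definition styl :: "nat \<Rightarrow> nat list set monoid" where
  "styl n = presented_monoid {1..n} (styl_rels n)"

definition word_star :: "nat \<Rightarrow> nat list \<Rightarrow> nat list" where
  "word_star n w = rev (map (\<lambda>x. n + 1 - x) w)"

definition styl_star :: "nat \<Rightarrow> nat list set \<Rightarrow> nat list set" where
  "styl_star n X = (\<Union>w\<in>X. styl_cong n `` {word_star n w})"

lemma word_star_lists: "w \<in> lists {1..n} \<Longrightarrow> word_star n w \<in> lists {1..n}"
  by (induction w) (auto simp: word_star_def)

lemma word_star_word_star: "w \<in> lists {1..n} \<Longrightarrow> word_star n (word_star n w) = w"
  by (induction w) (auto simp: word_star_def rev_map)

lemma word_star_append: "word_star n (u @ v) = word_star n v @ word_star n u"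
  by (simp add: word_star_def)

lemma word_star_rels:
  assumes "(u, v) \<in> styl_rels n"
  shows "(word_star n u, word_star n v) \<in> styl_rels n \<or> (word_star n v, word_star n u) \<in> styl_rels n"
  using assms by (auto simp: styl_rels_def word_star_def)

lemma word_star_cong: "(u, v) \<in> styl_cong n \<Longrightarrow> (word_star n u, word_star n v) \<in> styl_cong n"
  unfolding styl_cong_def
proof (induction rule: cong_gen.induct)
  case (rel u v)
  then have "word_star n u \<in> lists {1..n}" "word_star n v \<in> lists {1..n}"
    by (simp_all only: word_star_lists)
  with word_star_rels[OF rel(1)] show ?case
    by (elim disjE) (rule cong_gen.rel cong_gen.sym[OF cong_gen.rel]; assumption)+
next
  case (refl u)
  then show ?case by (intro cong_gen.refl word_star_lists)
next
  case (sym u v)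
  show ?case by (rule cong_gen.sym) (rule sym.IH)
next
  case (trans u v w)
  show ?case by (rule cong_gen.trans) (rule trans.IH)+
next
  case (append u v u' v')
  show ?case unfolding word_star_append by (rule cong_gen.append) (rule append.IH)+
qed

lemma styl_star_class:
  assumes "w \<in> lists {1..n}"
  shows "styl_star n (styl_cong n `` {w}) = styl_cong n `` {word_star n w}"
proof -
  have eq: "equiv (lists {1..n}) (styl_cong n)" unfolding styl_cong_def by (rule equiv_cong_gen)
  have "(\<lambda>w. styl_cong n `` {word_star n w}) respects styl_cong n"
    by (auto simp: congruent_def intro!: equiv_class_eq[OF eq] word_star_cong)
  from UN_equiv_class[OF eq this assms] show ?thesis by (simp add: styl_star_def)
qed

lemma involution_monoid_styl: "involution_monoid (styl n) (styl_star n)"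
proof -
  interpret monoid "styl n" unfolding styl_def by (rule monoid_presented)
  have c: "carrier (styl n) = lists {1..n} // styl_cong n"
    by (simp add: styl_def styl_cong_def presented_monoid_def)
  have m: "styl_cong n `` {u} \<otimes>\<^bsub>styl n\<^esub> styl_cong n `` {v} = styl_cong n `` {u @ v}"
    if "u \<in> lists {1..n}" "v \<in> lists {1..n}" for u v
    using presented_mult[OF that] by (simp add: styl_def styl_cong_def)
  show ?thesis
  proof unfold_locales
    show "styl_star n x \<in> carrier (styl n)" if "x \<in> carrier (styl n)" for x
      using that unfolding c
      by (elim quotientE) (simp only: styl_star_class word_star_lists quotientI)
    show "styl_star n (styl_star n x) = x" if "x \<in> carrier (styl n)" for x
      using that unfolding c
      by (elim quotientE) (simp only: styl_star_class word_star_lists word_star_word_star)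
    show "styl_star n (x \<otimes>\<^bsub>styl n\<^esub> y) = styl_star n y \<otimes>\<^bsub>styl n\<^esub> styl_star n x"
      if "x \<in> carrier (styl n)" "y \<in> carrier (styl n)" for x y
      using that unfolding c
      by (elim quotientE)
        (simp only: m styl_star_class word_star_lists word_star_append append_in_lists_conv)
  qed
qed

end

theory Submission
  imports Defs "HOL-Library.Sublist"
begin

text \<open>
  Two words are equal in \<open>styl n\<close> iff for every interval of letters their longest strictly
  decreasing subsequences inside that interval have the same length. Substituting into identities,
  every equation between words over the variables and their stars that holds in the stylic monoid
  preserves the subsequences of length at most \<open>n div 2\<close> and some tests of length \<open>2 * (n div 2)\<close>.

  For \<open>n \<ge> 2\<close> there are words \<open>W\<close> in \<open>x\<^sub>0, \<dots>, x\<^sub>k, z\<close> for which \<open>W \<approx> W\<^sup>*\<close> holds. In the middle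
  part of a word equivalent to \<open>W\<close>, the intervals from the last \<open>x\<^sub>a\<close> to the first \<open>x\<^sub>a\<^sup>*\<close> overlap
  exactly for neighbouring indices, so they are linearly arranged in one of two opposite directions;
  \<open>W\<close> and \<open>W\<^sup>*\<close> have opposite ones. An identity with few literals cannot change the
  direction: one of its variables is replaced by a word that contains a long piece of the
  arrangement, and a fresh letter put into that piece has to stay in the middle part. So the words
  with the direction of \<open>W\<close> define, through their syntactic congruence, an involution monoid
  that satisfies every identity with few literals but not \<open>W \<approx> W\<^sup>*\<close>.

  For \<open>n = 1\<close> the monoid is the two-element semilattice with trivial involution.
\<close>

text \<open>With \<open>h = n div 2\<close>, up to \<open>h\<close> literals can be tested exactly,
  because they fit into the upper half of the alphabet, where a letter determines its literal.
  Longer tests also need the lower half, whose letters are forced by mirroring, so a test of length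
  \<open>2 * h\<close> may confuse a literal with the star of the literal opposite to it. The
  direction of the arrangement must be visible to such full tests only, since otherwise
  \<open>W\<close> and \<open>W*\<close> would differ in the monoid. Hence a pair
  \<open>x_a* x_b\<close> is padded to length \<open>2 * h\<close> by \<open>s = h - 1\<close>
  copies of \<open>z\<close> in front and of \<open>z*\<close> behind, and the outer parts of
  \<open>W\<close> are rich enough that \<open>W\<close> and \<open>W*\<close> agree on shorter
  patterns. To carry such a frame through a short identity, only tests of at most
  \<open>s + 1\<close> literals are exact. The fresh letter followed by \<open>s\<close> copies of
  \<open>z*\<close> is one, and it secures the right half of the frame. For the left half,
  \<open>W\<close> has no increasing run of \<open>s\<close> variables before its last
  \<open>z\<close>; a run found behind the fresh letter therefore rules out any later
  \<open>z\<close>. Each of \<open>K\<close> pieces of the arrangement must supply such a run,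
  whence \<open>k = K * Suc s + 1\<close>.\<close>

section \<open>The word problem of the stylic monoid\<close>

text \<open>The columns of the tableaux: \<open>ins a\<close> bumps the largest entry that is at most \<open>a\<close> from a
  strictly decreasing list.\<close>

primrec ins :: "nat \<Rightarrow> nat list \<Rightarrow> nat list" where
  "ins a [] = [a]"
| "ins a (c # cs) = (if a < c then c # ins a cs else a # cs)"

definition col :: "nat list \<Rightarrow> nat list" where
  "col w = fold ins w []"

lemma col_Nil [simp]: "col [] = []"
  by (simp add: col_def)

lemma col_snoc [simp]: "col (w @ [a]) = ins a (col w)"
  by (simp add: col_def)

lemma ins_append_greater: "\<forall>c\<in>set g. a < c \<Longrightarrow> ins a g = g @ [a]"
  by (induction g) auto

lemma ins_bump: "\<lbrakk>\<forall>c\<in>set U. a < c; b \<le> a\<rbrakk> \<Longrightarrow> ins a (U @ b # D) = U @ a # D"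
  by (induction U) auto

lemma decreasing_cases:
  assumes "sorted_wrt (>) (g :: nat list)"
  obtains "\<forall>c\<in>set g. a < c"
  | U b D where "g = U @ b # D" "\<forall>c\<in>set U. a < c" "b \<le> a" "\<forall>c\<in>set D. c < b"
proof (cases "\<forall>c\<in>set g. a < c")
  case False
  then have "\<exists>c\<in>set g. c \<le> a" by (auto simp: not_less)
  from split_list_first_prop[OF this] obtain U b D
    where g: "g = U @ b # D" and b: "b \<le> a" and U: "\<forall>c\<in>set U. \<not> c \<le> a" by blast
  have "\<forall>c\<in>set D. c < b" using assms unfolding g by (simp add: sorted_wrt_append)
  with g b U show ?thesis by (intro that(2)) (auto simp: not_le)
qed (rule that(1))

lemma ins_set: "a \<in> set (ins a g)" "set (ins a g) \<subseteq> insert a (set g)"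
  by (induction g) auto

lemma ins_sorted: "sorted_wrt (>) g \<Longrightarrow> sorted_wrt (>) (ins a g)"
proof (induction g)
  case (Cons c g)
  have "x < c" if "x \<in> set (ins a g)" "a < c" for x
    using that ins_set(2)[of a g] Cons.prems by auto
  with Cons show ?case by (auto simp: not_less)
qed simp

lemma col_sorted: "sorted_wrt (>) (col w)"
  by (induction w rule: rev_induct) (auto intro: ins_sorted)

lemma col_subset: "set (col w) \<subseteq> set w"
proof (induction w rule: rev_induct)
  case (snoc a w)
  then show ?case using ins_set(2)[of a "col w"] by auto
qed simp

section \<open>Column insertion inside the stylic monoid\<close>

lemma styl_refl: "u \<in> lists {1..n} \<Longrightarrow> (u, u) \<in> styl_cong n"
  unfolding styl_cong_def by (rule cong_gen.refl)

lemma styl_sym: "(u, v) \<in> styl_cong n \<Longrightarrow> (v, u) \<in> styl_cong n"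
  unfolding styl_cong_def by (rule cong_gen.sym)

lemma styl_trans [trans]:
  "\<lbrakk>(u, v) \<in> styl_cong n; (v, w) \<in> styl_cong n\<rbrakk> \<Longrightarrow> (u, w) \<in> styl_cong n"
  unfolding styl_cong_def by (rule cong_gen.trans)

lemma styl_append:
  "\<lbrakk>(u, v) \<in> styl_cong n; (u', v') \<in> styl_cong n\<rbrakk> \<Longrightarrow> (u @ u', v @ v') \<in> styl_cong n"
  unfolding styl_cong_def by (rule cong_gen.append)

lemma styl_append_left:
  "\<lbrakk>(u, v) \<in> styl_cong n; p \<in> lists {1..n}\<rbrakk> \<Longrightarrow> (p @ u, p @ v) \<in> styl_cong n"
  by (rule styl_append[OF styl_refl])

lemma styl_append_right:
  "\<lbrakk>(u, v) \<in> styl_cong n; q \<in> lists {1..n}\<rbrakk> \<Longrightarrow> (u @ q, v @ q) \<in> styl_cong n"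
  by (rule styl_append[OF _ styl_refl])

lemma styl_Cons:
  "\<lbrakk>(u, v) \<in> styl_cong n; a \<in> {1..n}\<rbrakk> \<Longrightarrow> (a # u, a # v) \<in> styl_cong n"
  using styl_append_left[of u v n "[a]"] by simp

lemma styl_rel: "\<lbrakk>(u, v) \<in> styl_rels n\<rbrakk> \<Longrightarrow> (u, v) \<in> styl_cong n"
  unfolding styl_cong_def by (rule cong_gen.rel) (auto simp: styl_rels_def)

lemma styl_acb:
  assumes "a \<le> b" "b < c" "{a, b, c} \<subseteq> {1..n}"
  shows "([a, c, b], [c, a, b]) \<in> styl_cong n"
  by (rule styl_rel) (use assms in \<open>auto simp: styl_rels_def\<close>)

lemma styl_bac:
  assumes "a < b" "b \<le> c" "{a, b, c} \<subseteq> {1..n}"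
  shows "([b, a, c], [b, c, a]) \<in> styl_cong n"
  by (rule styl_rel) (use assms in \<open>auto simp: styl_rels_def\<close>)

lemma styl_aa:
  assumes "a \<in> {1..n}"
  shows "([a, a], [a]) \<in> styl_cong n"
  by (rule styl_rel) (use assms in \<open>auto simp: styl_rels_def\<close>)

text \<open>The letter \<open>a\<close> passes the entries of \<open>D\<close> from right to left:
  for neighbours \<open>e > d\<close> with \<open>e \<le> a\<close>, the relation
  \<open>bac = bca\<close> exchanges \<open>d\<close> and \<open>a\<close>.\<close>

lemma styl_move_left:
  assumes "sorted_wrt (>) (b # D)" "b \<le> a" "set (a # b # D) \<subseteq> {1..n}"
  shows "(b # D @ [a], b # a # D) \<in> styl_cong n"
  using assms
proof (induction D rule: rev_induct)
  case Nil
  then show ?case by (auto intro!: styl_refl)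
next
  case (snoc d D)
  obtain F e where F: "b # D = F @ [e]" by (metis append_butlast_last_id list.distinct(1))
  have e: "e \<in> set (b # D)" unfolding F by simp
  have "e \<le> b" using e snoc.prems by (auto simp: sorted_wrt_append)
  moreover have "d < e" using e snoc.prems by (auto simp: sorted_wrt_append)
  ultimately have "([e, d, a], [e, a, d]) \<in> styl_cong n"
    using snoc.prems e by (intro styl_bac) auto
  then have "(F @ [e, d, a], F @ [e, a, d]) \<in> styl_cong n"
  proof (rule styl_append_left)
    have "set F \<subseteq> set (b # D)" unfolding F by auto
    then show "F \<in> lists {1..n}" using snoc.prems by auto
  qed
  moreover have "F @ [e, d, a] = b # (D @ [d]) @ [a]"
    using F by (metis append.assoc append_Cons append_Nil)
  moreover have "F @ [e, a, d] = (b # D @ [a]) @ [d]"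
    using F by (metis append.assoc append_Cons append_Nil)
  moreover have "((b # D @ [a]) @ [d], (b # a # D) @ [d]) \<in> styl_cong n"
  proof (rule styl_append_right[OF snoc.IH])
    show "sorted_wrt (>) (b # D)" using snoc.prems by (auto simp: sorted_wrt_append)
  qed (use snoc.prems in auto)
  ultimately show ?case by (auto intro: styl_trans)
qed

text \<open>The letter \<open>b\<close> is exchanged with each entry of \<open>U\<close> by
  \<open>acb = cab\<close>. The third letter needed there is the next one in \<open>U @ [a]\<close>,
  which lies between the two.\<close>

lemma styl_move_right:
  assumes "sorted_wrt (>) U" "\<forall>c\<in>set U. a < c" "b \<le> a" "set (a # b # U) \<subseteq> {1..n}"
  shows "(U @ [b, a], b # U @ [a]) \<in> styl_cong n"
  using assms
proof (induction U)
  case Nil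
  then show ?case by (auto intro!: styl_refl)
next
  case (Cons u U)
  obtain x xs where x: "U @ [a] = x # xs" by (cases U) auto
  have xs: "set (x # xs) = insert a (set U)" unfolding x[symmetric] by auto
  then have "x = a \<or> x \<in> set U" by auto
  then have "b \<le> x" "x < u" "x \<in> {1..n}" using Cons.prems by auto
  then have "([b, u, x], [u, b, x]) \<in> styl_cong n" using Cons.prems by (intro styl_acb) auto
  then have "([u, b, x], [b, u, x]) \<in> styl_cong n" by (rule styl_sym)
  then have "([u, b, x] @ xs, [b, u, x] @ xs) \<in> styl_cong n"
    using xs Cons.prems by (intro styl_append_right) auto
  moreover have "(u # U @ [b, a], u # b # U @ [a]) \<in> styl_cong n"
    using Cons by (intro styl_Cons Cons.IH) auto
  ultimately show ?case using x by (auto intro: styl_trans)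
qed

text \<open>The \<open>a\<close> in front can be moved next to the \<open>a\<close> inside the
  column, where \<open>a^2 = a\<close> merges them.\<close>

lemma styl_absorb:
  assumes "sorted_wrt (>) g" "a \<in> set g" "set g \<subseteq> {1..n}"
  shows "(a # g, g) \<in> styl_cong n"
proof -
  obtain U D where g: "g = U @ a # D" using assms(2) by (meson split_list)
  have "(U @ [a, a], a # U @ [a]) \<in> styl_cong n"
    using assms unfolding g by (intro styl_move_right) (auto simp: sorted_wrt_append)
  then have "(a # U @ [a], U @ [a, a]) \<in> styl_cong n" by (rule styl_sym)
  also have "(U @ [a, a], U @ [a]) \<in> styl_cong n"
    using assms unfolding g by (intro styl_append_left styl_aa) auto
  finally have "((a # U @ [a]) @ D, (U @ [a]) @ D) \<in> styl_cong n"
    using assms unfolding g by (intro styl_append_right) auto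
  then show ?thesis unfolding g by simp
qed

text \<open>A Schensted insertion step from the Knuth relations alone: \<open>a\<close> moves left
  across the entries below \<open>b\<close>, then \<open>b\<close> moves left across those above
  it.\<close>

lemma styl_bump:
  assumes "sorted_wrt (>) g" "set g \<subseteq> {1..n}" "a \<in> {1..n}"
  shows "g @ [a] = ins a g \<or> (\<exists>b\<in>set g. b \<le> a \<and> (g @ [a], b # ins a g) \<in> styl_cong n)"
  using assms(1)
proof (cases rule: decreasing_cases[of g a])
  case 1
  then show ?thesis by (simp add: ins_append_greater)
next
  case (2 U b D)
  have s: "sorted_wrt (>) U" "sorted_wrt (>) (b # D)"
    using assms(1) unfolding 2 by (auto simp: sorted_wrt_append)
  have "(U @ b # D @ [a], U @ b # a # D) \<in> styl_cong n"
    using s assms 2 by (intro styl_append_left styl_move_left) auto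
  also have "((U @ [b, a]) @ D, (b # U @ [a]) @ D) \<in> styl_cong n"
    using s assms 2 by (intro styl_append_right styl_move_right) auto
  then have "(U @ b # a # D, b # U @ a # D) \<in> styl_cong n" by simp
  finally show ?thesis using 2 by (auto simp: ins_bump)
qed

lemma styl_plactic_normal:
  assumes "w \<in> lists {1..n}"
  shows "\<exists>T \<in> lists {1..n}. (w, T @ col w) \<in> styl_cong n"
  using assms
proof (induction w rule: rev_induct)
  case Nil
  then show ?case by (auto intro: styl_refl)
next
  case (snoc a w)
  then obtain T where T: "T \<in> lists {1..n}" "(w, T @ col w) \<in> styl_cong n" by auto
  have a: "a \<in> {1..n}" "set (col w) \<subseteq> {1..n}" using snoc.prems col_subset[of w] by auto
  from T a have "(w @ [a], (T @ col w) @ [a]) \<in> styl_cong n" by (intro styl_append_right) auto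
  then have *: "(w @ [a], T @ (col w @ [a])) \<in> styl_cong n" by simp
  from styl_bump[OF col_sorted a(2,1)] show ?case
  proof (elim disjE bexE conjE)
    assume "col w @ [a] = ins a (col w)"
    then show ?thesis using * T by auto
  next
    fix b assume b: "b \<in> set (col w)" "(col w @ [a], b # ins a (col w)) \<in> styl_cong n"
    have "(T @ (col w @ [a]), T @ (b # ins a (col w))) \<in> styl_cong n"
      by (rule styl_append_left[OF b(2) T(1)])
    with * have "(w @ [a], (T @ [b]) @ col (w @ [a])) \<in> styl_cong n"
      by (auto intro: styl_trans)
    moreover have "T @ [b] \<in> lists {1..n}" using T b a by auto
    ultimately show ?thesis by blast
  qed
qed

text \<open>Inserting a letter that is already in the column leaves \<open>col w\<close> as it is.
  The only trace is an entry of \<open>col w\<close> in front of the column, which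
  \<open>styl_absorb\<close> removes.\<close>

lemma styl_absorb_right:
  assumes "w \<in> lists {1..n}" "b \<in> set (col w)"
  shows "(w @ [b], w) \<in> styl_cong n"
proof -
  obtain T where T: "T \<in> lists {1..n}" "(w, T @ col w) \<in> styl_cong n"
    using styl_plactic_normal[OF assms(1)] by auto
  have s: "set (col w) \<subseteq> {1..n}" using assms(1) col_subset[of w] by auto
  have "(col w @ [b], col w) \<in> styl_cong n"
  proof (cases rule: decreasing_cases[OF col_sorted[of w], of b])
    case 1
    then show ?thesis using assms(2) by auto
  next
    case (2 U c D)
    have "c = b" using assms(2) 2 by force
    then have i: "ins b (col w) = col w" using 2 by (simp add: ins_bump)
    from styl_bump[OF col_sorted s, of b] assms(2) s
    obtain d where "d \<in> set (col w)" "(col w @ [b], d # ins b (col w)) \<in> styl_cong n"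
      by (metis i append_self_conv not_Cons_self2 subset_iff)
    moreover have "(d # col w, col w) \<in> styl_cong n"
      using calculation s by (intro styl_absorb col_sorted) auto
    ultimately show ?thesis unfolding i by (blast intro: styl_trans)
  qed
  then have "(T @ col w @ [b], T @ col w) \<in> styl_cong n" using T by (intro styl_append_left)
  moreover have "(w @ [b], (T @ col w) @ [b]) \<in> styl_cong n"
    using T assms s by (intro styl_append_right) auto
  ultimately show ?thesis using T by (metis append.assoc styl_sym styl_trans)
qed

text \<open>Inserting \<open>m\<close> can only remove smaller entries. For \<open>a < m\<close>,
  each column loses its largest entry that is at most \<open>a\<close>; if the entry lost by the
  larger column also occurs in the smaller one, it is lost there too.\<close>

lemma col_restrict:
  assumes "w \<in> lists {..m}"
  shows "set (col w) - {m} \<subseteq> set (col (filter (\<lambda>x. x < m) w))"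
  using assms
proof (induction w rule: rev_induct)
  case (snoc a w)
  let ?v = "filter (\<lambda>x. x < m) w"
  have IH: "set (col w) - {m} \<subseteq> set (col ?v)" and a: "a \<le> m" using snoc by auto
  show ?case
  proof (cases "a = m")
    case True
    then show ?thesis using IH ins_set(2)[of m "col w"] by auto
  next
    case False
    then have am: "a < m" using a by simp
    show ?thesis
    proof (cases rule: decreasing_cases[OF col_sorted[of ?v], of a])
      case 1
      then show ?thesis using IH am ins_set(2)[of a "col w"] by (auto simp: ins_append_greater)
    next
      case (2 U b D)
      have v: "set (ins a (col ?v)) = insert a (set (col ?v) - {b})"
        using 2 col_sorted[of ?v] by (auto simp: ins_bump sorted_wrt_append)
      have "set (ins a (col w)) \<subseteq> insert a (set (col w) - {b})"
      proof (cases rule: decreasing_cases[OF col_sorted[of w], of a])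
        case 1
        then show ?thesis using 2 by (auto simp: ins_append_greater)
      next
        case w: (2 U' b' D')
        have "b' \<in> set (col ?v)" using IH w am by auto
        then have "b' \<le> b" using 2 w(3) by auto
        then show ?thesis using w 2 col_sorted[of w] by (auto simp: ins_bump sorted_wrt_append)
      qed
      then show ?thesis using IH am v by auto
    qed
  qed
qed simp

text \<open>Iterating this splits a word into the columns of its restrictions to the letters up to
  \<open>n\<close>, \<open>n - 1\<close>, \<dots>, which gives a normal form.\<close>

lemma styl_split_col:
  assumes "w \<in> lists {1..m}" "m \<le> n"
  shows "(w, filter (\<lambda>x. x < m) w @ col w) \<in> styl_cong n"
  using assms
proof (induction w rule: rev_induct)
  case Nil
  then show ?case by (auto intro: styl_refl)
next
  case (snoc a w)
  let ?v = "filter (\<lambda>x. x < m) w" and ?c = "ins a (col w)"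
  have w: "w \<in> lists {1..m}" and a: "a \<in> {1..n}" "a \<le> m" using snoc.prems by auto
  have v: "?v \<in> lists {1..n}" and cw: "set (col w) \<subseteq> {1..n}" and c: "?c \<in> lists {1..n}"
    using w snoc.prems col_subset[of w] col_subset[of "w @ [a]"] by force+
  have "(w @ [a], (?v @ col w) @ [a]) \<in> styl_cong n"
    using snoc a by (intro styl_append_right) auto
  then have 1: "(w @ [a], ?v @ (col w @ [a])) \<in> styl_cong n" by simp
  have ab: "(b # ?c, ?c) \<in> styl_cong n" if "b \<in> set ?c" for b
    using that c by (intro styl_absorb ins_sorted col_sorted) auto
  have 2: "(?v @ (col w @ [a]), ?v @ ?c) \<in> styl_cong n"
    using styl_bump[OF col_sorted cw a(1)]
  proof (elim disjE bexE conjE)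
    assume "col w @ [a] = ?c"
    then show ?thesis using v c by (auto intro!: styl_refl)
  next
    fix b assume b: "b \<in> set (col w)" "b \<le> a" "(col w @ [a], b # ?c) \<in> styl_cong n"
    have "(?v @ (col w @ [a]), ?v @ (b # ?c)) \<in> styl_cong n"
      using b v by (intro styl_append_left)
    also have "(?v @ (b # ?c), ?v @ ?c) \<in> styl_cong n"
    \<comment> \<open>Only \<open>m\<close> itself can push out \<open>m\<close>, so a bumped
      \<open>m\<close> is still in the new column and is absorbed there. A smaller \<open>b\<close>
      lies in \<open>col ?v\<close> and is absorbed by \<open>?v\<close> instead.\<close>
    proof (cases "b = m")
      case True
      then have "b \<in> set ?c" using b(2) a ins_set(1)[of a] by auto
      then show ?thesis using v by (intro styl_append_left ab)
    next
      case False
      moreover have "set (col w) - {m} \<subseteq> set (col ?v)"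
        using w by (intro col_restrict) auto
      ultimately have "b \<in> set (col ?v)" using b(1) by auto
      then have "((?v @ [b]) @ ?c, ?v @ ?c) \<in> styl_cong n"
        using v c by (intro styl_append_right styl_absorb_right)
      then show ?thesis by simp
    qed
    finally show ?thesis .
  qed
  have 3: "(?v @ ?c, filter (\<lambda>x. x < m) (w @ [a]) @ ?c) \<in> styl_cong n"
  proof (cases "a < m")
    case True
    \<comment> \<open>The letter \<open>a\<close> has just entered \<open>?c\<close>, so absorption
      read backwards creates the copy that the filtered word needs.\<close>
    have "(?v @ ?c, ?v @ (a # ?c)) \<in> styl_cong n"
      using v by (intro styl_append_left styl_sym[OF ab] ins_set(1))
    then show ?thesis using True by simp
  next
    case False
    then show ?thesis using v c by (auto intro!: styl_refl)
  qed
  show ?case using styl_trans[OF styl_trans[OF 1 2] 3] by simp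
qed

text \<open>Prescribing the exact length loses nothing: parts of decreasing sequences are
  decreasing, so this says that the maximal length is at least \<open>d\<close>.\<close>

definition dec_in :: "nat \<Rightarrow> nat \<Rightarrow> nat \<Rightarrow> nat list \<Rightarrow> bool" where
  "dec_in i j d w \<longleftrightarrow>
     (\<exists>ys. subseq ys w \<and> sorted_wrt (>) ys \<and> set ys \<subseteq> {i..<j} \<and> length ys = d)"

lemma dec_in_append:
  assumes "i \<le> j"
  shows "dec_in i j d (u @ v) \<longleftrightarrow>
    (\<exists>t d1 d2. i \<le> t \<and> t \<le> j \<and> d = d1 + d2 \<and> dec_in t j d1 u \<and> dec_in i t d2 v)"
proof
  assume "dec_in i j d (u @ v)"
  then obtain ys where ys: "subseq ys (u @ v)" "sorted_wrt (>) ys" "set ys \<subseteq> {i..<j}" "length ys = d"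
    unfolding dec_in_def by auto
  then obtain y1 y2 where y: "ys = y1 @ y2" "subseq y1 u" "subseq y2 v"
    by (auto simp: subseq_append_iff)
  \<comment> \<open>The threshold lies just above the first entry taken from \<open>v\<close>, which
    all entries taken from \<open>u\<close> exceed.\<close>
  define t where "t = (if y2 = [] then i else Suc (hd y2))"
  have "dec_in t j (length y1) u"
    unfolding dec_in_def using ys y
    by (intro exI[of _ y1]) (cases y2; auto simp: t_def sorted_wrt_append Suc_le_eq)
  moreover have "dec_in i t (length y2) v"
    unfolding dec_in_def using ys y
    by (intro exI[of _ y2]) (cases y2; auto simp: t_def sorted_wrt_append less_Suc_eq)
  moreover have "i \<le> t" "t \<le> j"
    using ys y assms by (cases y2; auto simp: t_def)+
  ultimately show "\<exists>t d1 d2. i \<le> t \<and> t \<le> j \<and> d = d1 + d2 \<and> dec_in t j d1 u \<and> dec_in i t d2 v"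
    using ys y by auto
next
  assume "\<exists>t d1 d2. i \<le> t \<and> t \<le> j \<and> d = d1 + d2 \<and> dec_in t j d1 u \<and> dec_in i t d2 v"
  then obtain t y1 y2 where "i \<le> t" "t \<le> j" "d = length y1 + length y2"
    "subseq y1 u" "sorted_wrt (>) y1" "set y1 \<subseteq> {t..<j}"
    "subseq y2 v" "sorted_wrt (>) y2" "set y2 \<subseteq> {i..<t}"
    unfolding dec_in_def by auto
  then show "dec_in i j d (u @ v)"
    unfolding dec_in_def
    by (intro exI[of _ "y1 @ y2"]) (fastforce simp: sorted_wrt_append intro: list_emb_append_mono)
qed

lemma dec_in_Nil [simp]: "dec_in i j d [] \<longleftrightarrow> d = 0"
  by (auto simp: dec_in_def)

lemma dec_in_0 [simp]: "dec_in i j 0 w"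
  by (auto simp: dec_in_def)

lemma dec_in_less: "j \<le> i \<Longrightarrow> dec_in i j d w \<longleftrightarrow> d = 0"
  by (auto simp: dec_in_def)

lemma dec_in_Cons:
  "dec_in i j d (a # w) \<longleftrightarrow> dec_in i j d w \<or> (d > 0 \<and> a \<in> {i..<j} \<and> dec_in i a (d - 1) w)"
proof
  assume "dec_in i j d (a # w)"
  then obtain ys where ys: "subseq ys (a # w)" "sorted_wrt (>) ys" "set ys \<subseteq> {i..<j}" "length ys = d"
    unfolding dec_in_def by auto
  show "dec_in i j d w \<or> (d > 0 \<and> a \<in> {i..<j} \<and> dec_in i a (d - 1) w)"
  proof (cases "subseq ys w")
    case True
    then show ?thesis using ys unfolding dec_in_def by blast
  next
    case False
    then obtain zs where "ys = a # zs" "subseq zs w" using ys(1)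
      by (metis list_emb_Nil neq_Nil_conv subseq_Cons2_iff)
    then show ?thesis using ys unfolding dec_in_def by (auto intro!: exI[of _ zs])
  qed
next
  assume "dec_in i j d w \<or> (d > 0 \<and> a \<in> {i..<j} \<and> dec_in i a (d - 1) w)"
  then show "dec_in i j d (a # w)"
  proof (elim disjE conjE)
    assume "dec_in i j d w" then show ?thesis unfolding dec_in_def by blast
  next
    assume *: "d > 0" "a \<in> {i..<j}" "dec_in i a (d - 1) w"
    then obtain ys where "subseq ys w" "sorted_wrt (>) ys" "set ys \<subseteq> {i..<a}" "length ys = d - 1"
      unfolding dec_in_def by auto
    then show ?thesis using * unfolding dec_in_def
      by (intro exI[of _ "a # ys"]) auto
  qed
qed

lemma dec_in_singleton: "dec_in i j d [a] \<longleftrightarrow> d = 0 \<or> d = 1 \<and> a \<in> {i..<j}"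
  by (auto simp: dec_in_Cons)

lemma dec_in_snoc:
  "dec_in i j d (w @ [a]) \<longleftrightarrow>
     dec_in i j d w \<or> (d > 0 \<and> a \<in> {i..<j} \<and> dec_in (Suc a) j (d - 1) w)"
proof (cases "i \<le> j")
  case True
  show ?thesis
  proof
    assume "dec_in i j d (w @ [a])"
    then obtain t d1 d2 where *: "i \<le> t" "t \<le> j" "d = d1 + d2" "dec_in t j d1 w" "dec_in i t d2 [a]"
      using True by (auto simp: dec_in_append)
    have m: "dec_in k j d1 w" if "k \<le> t" for k
      using *(4) that unfolding dec_in_def by fastforce
    from m[of i] m[of "Suc a"] * show "dec_in i j d w \<or> (d > 0 \<and> a \<in> {i..<j} \<and> dec_in (Suc a) j (d - 1) w)"
      by (auto simp: dec_in_singleton split: if_splits)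
  next
    assume "dec_in i j d w \<or> (d > 0 \<and> a \<in> {i..<j} \<and> dec_in (Suc a) j (d - 1) w)"
    then show "dec_in i j d (w @ [a])"
    proof (elim disjE conjE)
      assume "dec_in i j d w" then show ?thesis unfolding dec_in_def by (auto intro: subseq_rev_drop_many)
    next
      assume "d > 0" "a \<in> {i..<j}" "dec_in (Suc a) j (d - 1) w"
      then show ?thesis using True unfolding dec_in_append[OF True]
        by (intro exI[of _ "Suc a"] exI[of _ "d - 1"] exI[of _ 1]) (auto simp: dec_in_singleton)
    qed
  qed
qed (auto simp: dec_in_less)

lemma dec_in_rels:
  assumes "(u, v) \<in> styl_rels n"
  shows "dec_in i j d u \<longleftrightarrow> dec_in i j d v"
  using assms unfolding styl_rels_def
  by (elim UnE; clarsimp simp: dec_in_Cons; fastforce)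

lemma styl_imp_dec_in: "(u, v) \<in> styl_cong n \<Longrightarrow> dec_in i j d u \<longleftrightarrow> dec_in i j d v"
  unfolding styl_cong_def
proof (induction arbitrary: i j d rule: cong_gen.induct)
  case (rel u v)
  then show ?case by (simp add: dec_in_rels)
next
  case (append u v u' v')
  then show ?case by (cases "i \<le> j") (simp_all add: dec_in_append dec_in_less)
qed auto

text \<open>Schensted's theorem for one column, with the lower bound \<open>i\<close> as a
  parameter; the generality in \<open>i\<close> feeds the induction, where
  \<open>dec_in_snoc\<close> raises the bound to \<open>Suc a\<close>.\<close>

lemma card_col:
  assumes "w \<in> lists {..<j}"
  shows "dec_in i j d w \<longleftrightarrow> d \<le> card {c \<in> set (col w). i \<le> c}"
  using assms
proof (induction w arbitrary: i d rule: rev_induct)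
  case (snoc a w)
  let ?N = "\<lambda>i. {c \<in> set (col w). i \<le> c}"
  have IH: "dec_in i j d w \<longleftrightarrow> d \<le> card (?N i)" for i d using snoc by auto
  have aj: "a < j" using snoc.prems by auto
  have lhs: "dec_in i j d (w @ [a]) \<longleftrightarrow> d \<le> card (?N i) \<or> (i \<le> a \<and> d \<le> Suc (card (?N (Suc a))))"
    unfolding dec_in_snoc IH using aj by auto
  show ?case
  proof (cases rule: decreasing_cases[OF col_sorted[of w], of a])
    case 1
    have e: "{c \<in> set (col (w @ [a])). i \<le> c} = (if i \<le> a then insert a (?N (Suc a)) else ?N i)"
      using 1 by (auto simp: ins_append_greater)
    show ?thesis
    proof (cases "i \<le> a")
      case True
      have "?N i \<subseteq> ?N (Suc a)" using 1 by auto
      then have "card (?N i) \<le> card (?N (Suc a))" by (rule card_mono[rotated]) simp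
      moreover have "card (insert a (?N (Suc a))) = Suc (card (?N (Suc a)))"
        by (rule card_insert_disjoint) auto
      ultimately show ?thesis unfolding lhs e using True by auto
    next
      case False
      then show ?thesis unfolding lhs e by simp
    qed
  next
    case (2 U b D)
    have e: "{c \<in> set (col (w @ [a])). i \<le> c} =
      (if i \<le> a then insert a (?N i - {b}) else ?N i)"
      using 2 col_sorted[of w] by (auto simp: ins_bump sorted_wrt_append)
    show ?thesis
    proof (cases "i \<le> a")
      case True
      have an: "a \<notin> ?N i - {b}" using 2 by auto
      show ?thesis
      proof (cases "i \<le> b")
        case b: True
        then have bi: "b \<in> ?N i" using 2 by auto
        then have "card (insert a (?N i - {b})) = card (?N i)"
          using an card_Suc_Diff1[OF _ bi] by (subst card_insert_disjoint) auto
        moreover have "Suc (card (?N (Suc a))) \<le> card (?N i)"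
        proof -
          have "insert b (?N (Suc a)) \<subseteq> ?N i" using 2 b True by auto
          then have "card (insert b (?N (Suc a))) \<le> card (?N i)" by (auto intro: card_mono)
          then show ?thesis using 2 by simp
        qed
        ultimately show ?thesis unfolding lhs e using True by auto
      next
        case False
        have "x \<le> b" if "x \<in> set (col w)" "x \<le> a" for x using that 2 by auto
        then have N: "?N i = ?N (Suc a)" using False True by (force simp: Suc_le_eq)
        have "card (insert a (?N i - {b})) = Suc (card (?N i))"
          using an False by (subst card_insert_disjoint) auto
        then show ?thesis unfolding lhs e using True unfolding N by auto
      qed
    next
      case False
      then show ?thesis unfolding lhs e by auto
    qed
  qed
qed simp

text \<open>By \<open>card_col\<close> the invariants give the number of entries from
  \<open>i\<close> on, and \<open>c\<close> is an entry exactly if this number jumps at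
  \<open>c\<close>.\<close>

lemma col_eqI:
  assumes "u \<in> lists {..<j}" "v \<in> lists {..<j}" "\<And>i d. dec_in i j d u \<longleftrightarrow> dec_in i j d v"
  shows "col u = col v"
proof -
  let ?N = "\<lambda>u i. {c \<in> set (col u). i \<le> c}"
  have N: "card (?N u i) = card (?N v i)" for i
  proof -
    have "d \<le> card (?N u i) \<longleftrightarrow> d \<le> card (?N v i)" for d
      using card_col[OF assms(1), of i d] card_col[OF assms(2), of i d] assms(3)[of i d] by blast
    from this[of "card (?N u i)"] this[of "card (?N v i)"] show ?thesis by simp
  qed
  have M: "c \<in> set (col u) \<longleftrightarrow> card (?N u (Suc c)) < card (?N u c)" for c u
  proof
    assume "c \<in> set (col u)"
    then have "insert c (?N u (Suc c)) \<subseteq> ?N u c" by (simp add: subset_eq)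
    then have "card (insert c (?N u (Suc c))) \<le> card (?N u c)" by (rule card_mono[rotated]) simp
    moreover have "card (insert c (?N u (Suc c))) = Suc (card (?N u (Suc c)))"
      by (rule card_insert_disjoint) simp_all
    ultimately show "card (?N u (Suc c)) < card (?N u c)" by simp
  next
    assume *: "card (?N u (Suc c)) < card (?N u c)"
    show "c \<in> set (col u)"
    proof (rule ccontr)
      assume "c \<notin> set (col u)"
      then have "Suc c \<le> x" if "x \<in> set (col u)" "c \<le> x" for x
        using that by (cases "x = c") simp_all
      then have "?N u c \<subseteq> ?N u (Suc c)" by blast
      then have "card (?N u c) \<le> card (?N u (Suc c))" by (intro card_mono) auto
      then show False using * by simp
    qed
  qed
  have s: "set (col u) = set (col v)"
  proof (rule Set.set_eqI)
    fix c
    have "c \<in> set (col u) \<longleftrightarrow> card (?N u (Suc c)) < card (?N u c)" by (rule M)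
    also have "\<dots> \<longleftrightarrow> card (?N v (Suc c)) < card (?N v c)" unfolding N ..
    also have "\<dots> \<longleftrightarrow> c \<in> set (col v)" by (rule M[symmetric])
    finally show "c \<in> set (col u) \<longleftrightarrow> c \<in> set (col v)" .
  qed
  have "sorted_wrt (<) (rev (col w))" for w using col_sorted[of w] by (simp add: sorted_wrt_rev)
  then have "rev (col u) = rev (col v)"
    using s by (intro strict_sorted_equal) auto
  then show ?thesis by simp
qed

lemma dec_in_filter:
  "dec_in i j d (filter (\<lambda>x. x < m) w) \<longleftrightarrow> dec_in i (min j m) d w"
proof (induction w arbitrary: j d)
  case (Cons a w)
  have "min a m = a" if "a < m" using that by simp
  then show ?case using Cons by (auto simp: dec_in_Cons)
qed simp

text \<open>Induction on the largest letter: \<open>styl_split_col\<close> splits off a column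
  determined by the invariants, and the word without the top letter has equal invariants because
  discarding large letters just shrinks the interval.\<close>

lemma dec_in_imp_styl:
  assumes "u \<in> lists {1..n}" "v \<in> lists {1..n}"
    and "\<And>i j d. i \<le> j \<Longrightarrow> dec_in i j d u \<longleftrightarrow> dec_in i j d v"
  shows "(u, v) \<in> styl_cong n"
proof -
  have *: "(u, v) \<in> styl_cong n" if "m \<le> n" "u \<in> lists {1..m}" "v \<in> lists {1..m}"
    "\<And>i j d. dec_in i j d u \<longleftrightarrow> dec_in i j d v" for m u v
    using that
  proof (induction m arbitrary: u v)
    case 0
    then have "set u = {}" "set v = {}" by auto
    then show ?case by (auto intro: styl_refl)
  next
    case (Suc m)
    let ?f = "filter (\<lambda>x. x < Suc m)"
    have "dec_in i j d (?f u) \<longleftrightarrow> dec_in i j d (?f v)" for i j d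
      unfolding dec_in_filter by (rule Suc.prems(4))
    then have "(?f u, ?f v) \<in> styl_cong n"
      using Suc.prems(1-3) by (intro Suc.IH) auto
    moreover have c: "col u = col v"
      using Suc.prems by (intro col_eqI[of _ "Suc (Suc m)"]) auto
    moreover have "col v \<in> lists {1..n}" using Suc.prems col_subset[of v] by force
    ultimately have "(?f u @ col u, ?f v @ col v) \<in> styl_cong n"
      by (simp add: styl_append_right)
    with styl_split_col[OF Suc.prems(2,1)] have "(u, ?f v @ col v) \<in> styl_cong n"
      by (rule styl_trans)
    also have "(?f v @ col v, v) \<in> styl_cong n"
      by (rule styl_sym[OF styl_split_col[OF Suc.prems(3,1)]])
    finally show ?case .
  qed
  have "dec_in i j d u \<longleftrightarrow> dec_in i j d v" for i j d
    using assms(3) by (cases "i \<le> j") (auto simp: dec_in_less)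
  then show ?thesis using * assms by blast
qed


section \<open>Identities as pairs of words over literals\<close>

type_synonym lit = "bool \<times> nat"

text \<open>The literal \<open>(False, i)\<close> is the \<open>i\<close>-th variable and \<open>(True, i)\<close> its star.\<close>

definition bar :: "lit \<Rightarrow> lit" where
  "bar p = (\<not> fst p, snd p)"

definition lstar :: "lit list \<Rightarrow> lit list" where
  "lstar w = rev (map bar w)"

text \<open>The involution \<open>st\<close> is a parameter so that the same definitions serve
  evaluation in letters (\<open>word_star n\<close>) and substitution into identities
  (\<open>lstar\<close>).\<close>

definition simg :: "('a list \<Rightarrow> 'a list) \<Rightarrow> (nat \<Rightarrow> 'a list) \<Rightarrow> lit \<Rightarrow> 'a list" where
  "simg st f p = (if fst p then st (f (snd p)) else f (snd p))"

definition subst :: "('a list \<Rightarrow> 'a list) \<Rightarrow> (nat \<Rightarrow> 'a list) \<Rightarrow> lit list \<Rightarrow> 'a list" where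
  "subst st f u = concat (map (simg st f) u)"

primrec nf :: "iterm \<Rightarrow> lit list" where
  "nf (Var i) = [(False, i)]"
| "nf One = []"
| "nf (Times u v) = nf u @ nf v"
| "nf (Star u) = lstar (nf u)"

definition holds :: "nat \<Rightarrow> lit list \<Rightarrow> lit list \<Rightarrow> bool" where
  "holds n u v \<longleftrightarrow> (\<forall>f. (\<forall>i. f i \<in> lists {1..n}) \<longrightarrow>
     (subst (word_star n) f u, subst (word_star n) f v) \<in> styl_cong n)"

lemma bar_bar [simp]: "bar (bar p) = p"
  by (simp add: bar_def)

lemma bar_simps [simp]: "bar (True, i) = (False, i)" "bar (False, i) = (True, i)"
  by (simp_all add: bar_def)

lemma lstar_simps [simp]:
  "lstar [] = []" "lstar (p # u) = lstar u @ [bar p]" "lstar (u @ v) = lstar v @ lstar u"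
  by (simp_all add: lstar_def)

lemma lstar_lstar [simp]: "lstar (lstar u) = u"
  by (induction u) auto

lemma length_lstar [simp]: "length (lstar u) = length u"
  by (simp add: lstar_def)

lemma set_lstar [simp]: "set (lstar u) = bar ` set u"
  by (simp add: lstar_def)

lemma subseq_rev: "subseq (rev u) (rev v) \<longleftrightarrow> subseq u v"
proof -
  have "subseq (rev u) (rev v)" if "subseq u v" for u v :: "'a list"
    using that by (induction rule: list_emb.induct) (auto intro: list_emb_append_mono subseq_rev_drop_many)
  from this[of u v] this[of "rev u" "rev v"] show ?thesis by auto
qed

lemma subseq_lstar_imp: "subseq u v \<Longrightarrow> subseq (lstar u) (lstar v)"
  unfolding lstar_def subseq_rev by (rule subseq_map)

lemma subseq_lstar: "subseq u (lstar v) \<longleftrightarrow> subseq (lstar u) v"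
  using subseq_lstar_imp[of u "lstar v"] subseq_lstar_imp[of "lstar u" v] by auto

lemma subst_simps [simp]:
  "subst st f [] = []" "subst st f (p # u) = simg st f p @ subst st f u"
  "subst st f (u @ v) = subst st f u @ subst st f v"
  by (simp_all add: subst_def)

lemma simg_bar_word_star:
  assumes "\<And>i. f i \<in> lists {1..n}"
  shows "simg (word_star n) f (bar p) = word_star n (simg (word_star n) f p)"
  using word_star_word_star[OF assms] by (auto simp: simg_def bar_def)

lemma subst_word_star_lstar:
  assumes "\<And>i. f i \<in> lists {1..n}"
  shows "subst (word_star n) f (lstar u) = word_star n (subst (word_star n) f u)"
  by (induction u) (auto simp: word_star_append simg_bar_word_star[OF assms], simp add: word_star_def)

lemma simg_bar_lstar: "simg lstar f (bar p) = lstar (simg lstar f p)"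
  by (auto simp: simg_def bar_def)

lemma subst_lstar_lstar: "subst lstar f (lstar u) = lstar (subst lstar f u)"
  by (induction u) (auto simp: simg_bar_lstar)

lemma simg_lists:
  assumes "\<And>i. f i \<in> lists {1..n}"
  shows "simg (word_star n) f p \<in> lists {1..n}"
  unfolding simg_def using assms word_star_lists[OF assms] by presburger

lemma subst_lists:
  assumes "\<And>i. f i \<in> lists {1..n}"
  shows "subst (word_star n) f u \<in> lists {1..n}"
proof (induction u)
  case (Cons p u)
  then show ?case using simg_lists[of f n, OF assms, where p = p] by simp
qed simp

lemma subst_subst:
  assumes "\<And>i. g i \<in> lists {1..n}"
  shows "subst (word_star n) g (subst lstar f u) =
    subst (word_star n) (\<lambda>i. subst (word_star n) g (f i)) u"
  by (induction u) (auto simp: simg_def subst_word_star_lstar[OF assms])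

lemma holds_refl: "holds n u u"
  unfolding holds_def by (intro allI impI styl_refl subst_lists) blast

lemma holds_sym: "holds n u v \<Longrightarrow> holds n v u"
  unfolding holds_def by (meson styl_sym)

lemma holds_trans: "holds n u v \<Longrightarrow> holds n v w \<Longrightarrow> holds n u w"
  unfolding holds_def by (meson styl_trans)

lemma holds_append: "holds n u v \<Longrightarrow> holds n u' v' \<Longrightarrow> holds n (u @ u') (v @ v')"
  unfolding holds_def subst_simps by (meson styl_append)

lemma holds_lstar: "holds n u v \<Longrightarrow> holds n (lstar u) (lstar v)"
  unfolding holds_def by (simp add: subst_word_star_lstar word_star_cong del: in_lists_conv_set)

lemma holds_subst: "holds n u v \<Longrightarrow> holds n (subst lstar f u) (subst lstar f v)"
  unfolding holds_def
proof (intro allI impI)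
  fix g :: "nat \<Rightarrow> nat list"
  assume h: "\<forall>f. (\<forall>i. f i \<in> lists {1..n}) \<longrightarrow>
      (subst (word_star n) f u, subst (word_star n) f v) \<in> styl_cong n"
    and g: "\<forall>i. g i \<in> lists {1..n}"
  then have g': "\<And>i. g i \<in> lists {1..n}" by blast
  then have "\<forall>i. subst (word_star n) g (f i) \<in> lists {1..n}" by (intro allI subst_lists)
  then show "(subst (word_star n) g (subst lstar f u), subst (word_star n) g (subst lstar f v)) \<in> styl_cong n"
    unfolding subst_subst[OF g'] by (rule h[THEN spec, THEN mp])
qed

lemma styl_carrier: "carrier (styl n) = lists {1..n} // styl_cong n"
  by (simp add: styl_def styl_cong_def presented_monoid_def)

lemma eval_styl:
  assumes f: "\<And>i. f i \<in> lists {1..n}"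
  shows "eval (styl n) (styl_star n) (\<lambda>i. styl_cong n `` {f i}) t =
    styl_cong n `` {subst (word_star n) f (nf t)}"
proof (induction t)
  case One
  then show ?case by (simp add: styl_def presented_monoid_def styl_cong_def)
next
  case (Times t u)
  then show ?case
    using presented_mult[OF subst_lists[OF f] subst_lists[OF f], where R = "styl_rels n"]
    by (simp add: styl_def styl_cong_def)
next
  case (Star t)
  then show ?case by (simp add: styl_star_class[OF subst_lists[OF f]] subst_word_star_lstar[OF f])
qed (simp add: simg_def)

lemma satisfies_styl: "satisfies (styl n) (styl_star n) (s, t) \<longleftrightarrow> holds n (nf s) (nf t)"
proof -
  have eq: "equiv (lists {1..n}) (styl_cong n)" unfolding styl_cong_def by (rule equiv_cong_gen)
  have ev: "eval (styl n) (styl_star n) (\<lambda>i. styl_cong n `` {f i}) s =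
      eval (styl n) (styl_star n) (\<lambda>i. styl_cong n `` {f i}) t \<longleftrightarrow>
    (subst (word_star n) f (nf s), subst (word_star n) f (nf t)) \<in> styl_cong n"
    if "\<And>i. f i \<in> lists {1..n}" for f
    unfolding eval_styl[OF that]
    by (rule eq_equiv_class_iff[OF eq subst_lists[OF that] subst_lists[OF that]])
  show ?thesis
  proof
    assume *: "satisfies (styl n) (styl_star n) (s, t)"
    show "holds n (nf s) (nf t)"
      unfolding holds_def
    proof (intro allI impI)
      fix f :: "nat \<Rightarrow> nat list" assume f: "\<forall>i. f i \<in> lists {1..n}"
      then have f': "\<And>i. f i \<in> lists {1..n}" by blast
      have a: "\<forall>i. styl_cong n `` {f i} \<in> carrier (styl n)"
        unfolding styl_carrier by (intro allI quotientI f')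
      have "eval (styl n) (styl_star n) (\<lambda>i. styl_cong n `` {f i}) s =
          eval (styl n) (styl_star n) (\<lambda>i. styl_cong n `` {f i}) t"
        by (rule *[unfolded satisfies_def fst_conv snd_conv, THEN spec, THEN mp, OF a])
      then show "(subst (word_star n) f (nf s), subst (word_star n) f (nf t)) \<in> styl_cong n"
        by (rule iffD1[OF ev[OF f']])
    qed
  next
    assume *: "holds n (nf s) (nf t)"
    show "satisfies (styl n) (styl_star n) (s, t)"
      unfolding satisfies_def
    proof (intro allI impI)
      fix F :: "nat \<Rightarrow> nat list set" assume "\<forall>i. F i \<in> carrier (styl n)"
      then have "\<exists>w. w \<in> lists {1..n} \<and> F i = styl_cong n `` {w}" for i
        unfolding styl_carrier by (meson quotientE)
      then obtain f where f: "\<And>i. f i \<in> lists {1..n}" "\<And>i. F i = styl_cong n `` {f i}"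
        by metis
      have F: "F = (\<lambda>i. styl_cong n `` {f i})" using f(2) by auto
      show "eval (styl n) (styl_star n) F (fst (s, t)) = eval (styl n) (styl_star n) F (snd (s, t))"
        unfolding F fst_conv snd_conv ev[OF f(1)] using * f(1) unfolding holds_def by blast
    qed
  qed
qed

primrec term_of :: "lit list \<Rightarrow> iterm" where
  "term_of [] = One"
| "term_of (p # u) = Times (if fst p then Star (Var (snd p)) else Var (snd p)) (term_of u)"

lemma nf_term_of [simp]: "nf (term_of u) = u"
  by (induction u) auto


section \<open>Tests\<close>

text \<open>The pieces are nonempty, so \<open>m\<close> lists exactly the literals that contribute
  and is no longer than \<open>ys\<close>.\<close>

lemma subseq_concat_map:
  "subseq ys (concat (map L u)) \<longleftrightarrow>
    (\<exists>m yss. subseq m u \<and> list_all2 (\<lambda>z p. z \<noteq> [] \<and> subseq z (L p)) yss m \<and> ys = concat yss)"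
proof
  show "subseq ys (concat (map L u)) \<Longrightarrow>
    \<exists>m yss. subseq m u \<and> list_all2 (\<lambda>z p. z \<noteq> [] \<and> subseq z (L p)) yss m \<and> ys = concat yss"
  proof (induction u arbitrary: ys)
    case Nil
    then show ?case by (intro exI[of _ "[]"]) auto
  next
    case (Cons p u)
    then obtain y1 y2 where y: "ys = y1 @ y2" "subseq y1 (L p)" "subseq y2 (concat (map L u))"
      by (auto simp: subseq_append_iff)
    from Cons.IH[OF y(3)] obtain m yss where
      m: "subseq m u" "list_all2 (\<lambda>z p. z \<noteq> [] \<and> subseq z (L p)) yss m" "y2 = concat yss" by auto
    show ?case
    proof (cases "y1 = []")
      case True
      then show ?thesis using y m by (intro exI[of _ m] exI[of _ yss]) auto
    next
      case False
      then show ?thesis using y m by (intro exI[of _ "p # m"] exI[of _ "y1 # yss"]) auto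
    qed
  qed
next
  assume "\<exists>m yss. subseq m u \<and> list_all2 (\<lambda>z p. z \<noteq> [] \<and> subseq z (L p)) yss m \<and> ys = concat yss"
  then obtain m yss where "subseq m u" "list_all2 (\<lambda>z p. z \<noteq> [] \<and> subseq z (L p)) yss m" "ys = concat yss"
    by auto
  then show "subseq ys (concat (map L u))"
  proof (induction arbitrary: ys yss rule: list_emb.induct)
    case (list_emb_Cons2 p q m u)
    then obtain z zs where z: "yss = z # zs" "subseq z (L p)" "list_all2 (\<lambda>z p. z \<noteq> [] \<and> subseq z (L p)) zs m"
      by (auto simp: list_all2_Cons2)
    then show ?case using list_emb_Cons2 by (auto intro: list_emb_append_mono)
  qed (auto intro: subseq_drop_many)
qed

lemma length_le_concat: "[] \<notin> set yss \<Longrightarrow> length yss \<le> length (concat yss)"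
proof (induction yss)
  case (Cons z zs)
  then show ?case by (cases z) auto
qed simp

lemma concat_singletons:
  assumes "[] \<notin> set yss" "length (concat yss) \<le> length yss"
  shows "yss = map (\<lambda>y. [y]) (concat yss)"
  using assms
proof (induction yss)
  case (Cons z zs)
  obtain a z' where z: "z = a # z'" using Cons.prems by (cases z) auto
  then have "length z' = 0" using Cons.prems length_le_concat[of zs] by (simp del: length_0_conv)
  then show ?case using Cons z by simp
qed simp

lemma subseq_sorted_wrt: "subseq z w \<Longrightarrow> sorted_wrt P w \<Longrightarrow> sorted_wrt P z"
  by (induction rule: list_emb.induct) (auto dest: list_emb_set)

text \<open>A decreasing sequence meets each increasing block at most once, so it amounts to
  choosing one letter for every literal of \<open>m\<close>.\<close>

lemma dec_in_ascending:
  assumes "\<And>p. sorted_wrt (<) (L p)"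
  shows "dec_in i j d (concat (map L u)) \<longleftrightarrow>
    (\<exists>m ys. subseq m u \<and> list_all2 (\<lambda>y p. y \<in> set (L p)) ys m \<and>
      sorted_wrt (>) ys \<and> set ys \<subseteq> {i..<j} \<and> length ys = d)"
proof
  assume "dec_in i j d (concat (map L u))"
  then obtain ys m yss where ys: "sorted_wrt (>) ys" "set ys \<subseteq> {i..<j}" "length ys = d" "ys = concat yss"
    and m: "subseq m u" "list_all2 (\<lambda>z p. z \<noteq> [] \<and> subseq z (L p)) yss m"
    unfolding dec_in_def subseq_concat_map by auto
  have one: "length z = 1 \<and> hd z \<in> set (L p)"
    if "z \<noteq> []" "subseq z (L p)" "sorted_wrt (>) z" for z p
  proof -
    have "sorted_wrt (<) z" using subseq_sorted_wrt[OF that(2) assms] .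
    then have "length z = 1" using that(1,3) by (cases z; cases "tl z") auto
    then show ?thesis using that(2) by (auto simp: length_Suc_conv subseq_singleton_left)
  qed
  from m(2) ys(1) have "list_all2 (\<lambda>y p. y \<in> set (L p)) (concat yss) m \<and> length (concat yss) = length m"
    unfolding ys(4)
  proof (induction rule: list_all2_induct)
    case (Cons z zs p m)
    then have "length z = 1" "hd z \<in> set (L p)"
      using one[of z p] by (auto simp: sorted_wrt_append)
    then show ?case using Cons by (cases z) (auto simp: sorted_wrt_append)
  qed simp
  then show "\<exists>m ys. subseq m u \<and> list_all2 (\<lambda>y p. y \<in> set (L p)) ys m \<and>
      sorted_wrt (>) ys \<and> set ys \<subseteq> {i..<j} \<and> length ys = d"
    using m ys by (intro exI[of _ m] exI[of _ "concat yss"]) auto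
next
  assume "\<exists>m ys. subseq m u \<and> list_all2 (\<lambda>y p. y \<in> set (L p)) ys m \<and>
      sorted_wrt (>) ys \<and> set ys \<subseteq> {i..<j} \<and> length ys = d"
  then obtain m ys where m: "subseq m u" "list_all2 (\<lambda>y p. y \<in> set (L p)) ys m"
    and ys: "sorted_wrt (>) ys" "set ys \<subseteq> {i..<j}" "length ys = d" by auto
  have "list_all2 (\<lambda>z p. z \<noteq> [] \<and> subseq z (L p)) (map (\<lambda>y. [y]) ys) m"
    using m(2) by (auto simp: list_all2_conv_all_nth subseq_singleton_left)
  moreover have "concat (map (\<lambda>y. [y]) ys) = ys" by (induction ys) auto
  ultimately show "dec_in i j d (concat (map L u))"
    unfolding dec_in_def subseq_concat_map using m(1) ys
    by (intro exI[of _ ys] conjI exI[of _ m] exI[of _ "map (\<lambda>y. [y]) ys"]) simp_all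
qed

lemma decreasing_unique:
  assumes "sorted_wrt (>) ys" "sorted_wrt (>) zs" "set ys \<subseteq> set zs" "length zs \<le> length ys"
  shows "ys = (zs :: nat list)"
proof -
  have d: "sorted_wrt (<) (rev ys)" "sorted_wrt (<) (rev zs)" using assms by (simp_all add: sorted_wrt_rev)
  then have "distinct (rev ys)" "distinct (rev zs)" by (simp_all only: strict_sorted_iff)
  then have "card (set zs) \<le> card (set ys)" using assms(4) by (simp add: distinct_card)
  then have "set ys = set zs" using assms(3) by (simp add: card_seteq)
  then have "rev zs = rev ys" using d by (intro strict_sorted_equal) auto
  then show ?thesis by simp
qed

text \<open>Letter \<open>n - t\<close> is assigned to the literals in \<open>P t\<close>; the involution then forces letter
  \<open>t + 1\<close> onto their stars.\<close>

definition test_letters :: "nat \<Rightarrow> (nat \<Rightarrow> lit set) \<Rightarrow> lit \<Rightarrow> nat set" where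
  "test_letters n P p =
     {y. \<exists>t < n div 2. (y = n - t \<and> p \<in> P t) \<or> (y = t + 1 \<and> bar p \<in> P t)}"

text \<open>Every variable is sent to the increasing word of its test letters. Reversal combined
  with complementation keeps words increasing, so \<open>dec_in_ascending\<close> applies to starred
  literals as well.\<close>

lemma holds_test:
  assumes "holds n u v" "subseq m u" "list_all2 (\<lambda>y p. y \<in> test_letters n P p) ys m"
    "sorted_wrt (>) ys" "set ys \<subseteq> {i..<j}"
  shows "\<exists>m' ys'. subseq m' v \<and> list_all2 (\<lambda>y p. y \<in> test_letters n P p) ys' m' \<and>
    sorted_wrt (>) ys' \<and> set ys' \<subseteq> {i..<j} \<and> length ys' = length ys"
proof -
  define f where "f = (\<lambda>i. sorted_list_of_set (test_letters n P (False, i)))"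
  have sub: "test_letters n P p \<subseteq> {1..n}" for p by (auto simp: test_letters_def)
  then have fin: "finite (test_letters n P p)" for p by (rule finite_subset) simp
  have f: "\<And>i. f i \<in> lists {1..n}"
    unfolding f_def in_lists_conv_set set_sorted_list_of_set[OF fin] using sub by blast
  have mirror: "(\<lambda>x. n + 1 - x) ` test_letters n P p = test_letters n P (bar p)" for p
  proof -
    have "(\<lambda>x. n + 1 - x) ` test_letters n P p \<subseteq> test_letters n P (bar p)" for p
      unfolding test_letters_def by (auto; force)
    from this[of p] this[of "bar p"] have a: "(\<lambda>x. n + 1 - x) ` test_letters n P p \<subseteq> test_letters n P (bar p)"
      and b: "(\<lambda>x. n + 1 - x) ` test_letters n P (bar p) \<subseteq> test_letters n P p" by auto
    have "x \<in> (\<lambda>x. n + 1 - x) ` test_letters n P p" if "x \<in> test_letters n P (bar p)" for x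
    proof (rule image_eqI)
      show "n + 1 - x \<in> test_letters n P p" using b that by auto
      show "x = n + 1 - (n + 1 - x)" using that sub by fastforce
    qed
    with a show ?thesis by auto
  qed
  have set: "set (simg (word_star n) f p) = test_letters n P p" for p
    using mirror[of "bar p"] fin by (cases p) (auto simp: simg_def f_def word_star_def)
  have sorted: "sorted_wrt (<) (simg (word_star n) f p)" for p
  proof -
    have "sorted_wrt (<) (word_star n (f i))" for i
      unfolding word_star_def sorted_wrt_rev sorted_wrt_map
    proof (rule sorted_wrt_mono_rel)
      show "sorted_wrt (<) (f i)" by (simp add: f_def)
      fix x y assume "x \<in> set (f i)" "y \<in> set (f i)" "x < y"
      then have "y \<in> {1..n}"
        unfolding f_def set_sorted_list_of_set[OF fin] using sub by blast
      then show "n + 1 - y < n + 1 - x" using \<open>x < y\<close> by auto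
    qed
    then show ?thesis by (simp add: simg_def f_def)
  qed
  have "dec_in i j (length ys) (subst (word_star n) f u)"
    unfolding subst_def dec_in_ascending[OF sorted] set using assms by blast
  then have "dec_in i j (length ys) (subst (word_star n) f v)"
    using assms(1) f styl_imp_dec_in unfolding holds_def by blast
  then show ?thesis unfolding subst_def dec_in_ascending[OF sorted] set .
qed

text \<open>In the interval of the \<open>length m\<close> largest letters, which avoids the lower
  half, the letter \<open>n - t\<close> belongs to the literal \<open>m ! t\<close> alone. A
  decreasing sequence filling this interval therefore spells \<open>m\<close>.\<close>

lemma holds_short_subseq:
  assumes "holds n u v" "subseq m u" "2 * length m \<le> n"
  shows "subseq m v"
proof -
  let ?l = "length m" and ?P = "\<lambda>t. {p. t < length m \<and> p = m ! t}"
  define zs where "zs = map (\<lambda>t. n - t) [0..<?l]"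
  have zs: "sorted_wrt (>) zs"
    using assms(3) by (auto simp: zs_def sorted_wrt_iff_nth_less)
  have zset: "set zs = {n - ?l + 1..<n + 1}"
  proof -
    have "x \<in> (\<lambda>t. n - t) ` {0..<?l}" if "x \<in> {n - ?l + 1..<n + 1}" for x
      using that assms(3) by (intro image_eqI[of _ _ "n - x"]) auto
    then show ?thesis using assms(3) by (auto simp: zs_def)
  qed
  have am: "list_all2 (\<lambda>y p. y \<in> test_letters n ?P p) zs m"
  proof (rule list_all2_all_nthI)
    fix t assume "t < length zs"
    then have "t < ?l" by (simp add: zs_def)
    moreover from this have "t < n div 2" using assms(3) by linarith
    ultimately show "zs ! t \<in> test_letters n ?P (m ! t)"
      by (auto simp: zs_def test_letters_def)
  qed (simp add: zs_def)
  from holds_test[OF assms(1,2) am zs equalityD1[OF zset]] obtain m' ys where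
    m': "subseq m' v" "list_all2 (\<lambda>y p. y \<in> test_letters n ?P p) ys m'"
    and ys: "sorted_wrt (>) ys" "set ys \<subseteq> set zs" "length ys = length zs"
    unfolding zset by blast
  have "ys = zs" using ys zs by (intro decreasing_unique) auto
  then have l: "length m' = ?l" using m'(2) by (auto simp: list_all2_conv_all_nth zs_def)
  have "m' = m"
  proof (rule nth_equalityI[OF l])
    fix t assume t: "t < length m'"
    then have "n - t \<in> test_letters n ?P (m' ! t)"
      using m'(2) l unfolding \<open>ys = zs\<close> by (auto simp: list_all2_conv_all_nth zs_def)
    then obtain t' where "t' < n div 2" "t' < ?l"
      "n - t = n - t' \<and> m' ! t = m ! t' \<or> n - t = t' + 1"
      by (auto simp: test_letters_def)
    moreover from this have "t' = t" using t l assms(3) by linarith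
    ultimately show "m' ! t = m ! t" using t l assms(3) by auto
  qed
  then show ?thesis using m' by simp
qed

text \<open>Now the decreasing sequence has to use all test letters of both halves, so a single set
  \<open>P t\<close> governs two opposite positions.\<close>

lemma holds_full_test:
  assumes "holds n u v" "subseq m u" "h = n div 2" "length m = 2 * h"
    and P: "\<And>t. t < h \<Longrightarrow> m ! t \<in> P t \<and> bar (m ! (2 * h - 1 - t)) \<in> P t"
  shows "\<exists>m'. subseq m' v \<and> length m' = 2 * h \<and>
    (\<forall>t<h. m' ! t \<in> P t \<and> bar (m' ! (2 * h - 1 - t)) \<in> P t)"
proof -
  \<comment> \<open>For odd \<open>n\<close> the middle letter is skipped, as it is not a test
    letter.\<close>
  define zs where "zs = map (\<lambda>t. if t < h then n - t else 2 * h - t) [0..<2 * h]"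
  have hn: "2 * h \<le> n" using assms(3) by simp
  have zl: "length zs = 2 * h" by (simp add: zs_def)
  have zn: "zs ! t = (if t < h then n - t else 2 * h - t)" if "t < 2 * h" for t
    using that by (simp add: zs_def)
  have zs: "sorted_wrt (>) zs"
    using hn by (auto simp: zs_def sorted_wrt_iff_nth_less)
  have sub: "test_letters n P p \<subseteq> set zs" for p
  proof
    fix y assume "y \<in> test_letters n P p"
    then obtain t where t: "t < h" "y = n - t \<or> y = t + 1"
      using assms(3) by (auto simp: test_letters_def)
    from t(2) show "y \<in> set zs"
    proof
      assume "y = n - t"
      then have "y = zs ! t" using t zn by simp
      then show ?thesis using t zl by simp
    next
      assume "y = t + 1"
      then have "y = zs ! (2 * h - 1 - t)" using t by (subst zn) auto
      then show ?thesis using t zl by simp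
    qed
  qed
  have tz: "set ys \<subseteq> set zs" if "list_all2 (\<lambda>y p. y \<in> test_letters n P p) ys m'" for ys m'
  proof
    fix y assume "y \<in> set ys"
    then obtain t where "t < length ys" "y = ys ! t" by (auto simp: in_set_conv_nth)
    then have "y \<in> test_letters n P (m' ! t)" using list_all2_nthD[OF that] by simp
    then show "y \<in> set zs" using sub by blast
  qed
  have am: "list_all2 (\<lambda>y p. y \<in> test_letters n P p) zs m"
  proof (rule list_all2_all_nthI)
    fix t assume "t < length zs"
    then have t: "t < 2 * h" using zl by simp
    show "zs ! t \<in> test_letters n P (m ! t)"
    proof (cases "t < h")
      case True
      then show ?thesis using P[of t] t zn assms(3) by (auto simp: test_letters_def)
    next
      case False
      then have "bar (m ! t) \<in> P (2 * h - 1 - t)" using P[of "2 * h - 1 - t"] t by auto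
      then show ?thesis using False t zn assms(3)
        by (auto simp: test_letters_def intro!: exI[of _ "2 * h - 1 - t"])
    qed
  qed (simp add: zl assms)
  have "set zs \<subseteq> {0..<n + 1}" using hn by (auto simp: zs_def)
  from holds_test[OF assms(1,2) am zs this] obtain m' ys where
    m': "subseq m' v" "list_all2 (\<lambda>y p. y \<in> test_letters n P p) ys m'"
    and ys: "sorted_wrt (>) ys" "length ys = length zs"
    by (elim exE conjE)
  have eq: "ys = zs" by (rule decreasing_unique[OF ys(1) zs tz[OF m'(2)]]) (simp add: ys(2))
  then have l: "length m' = 2 * h" using m'(2) zl by (auto simp: list_all2_conv_all_nth)
  have *: "zs ! t \<in> test_letters n P (m' ! t)" if "t < 2 * h" for t
    using m'(2) that zl unfolding eq by (auto simp: list_all2_conv_all_nth)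
  have "m' ! t \<in> P t \<and> bar (m' ! (2 * h - 1 - t)) \<in> P t" if t: "t < h" for t
  proof
    have "n - t \<in> test_letters n P (m' ! t)" using *[of t] t zn[of t] by auto
    then obtain t' where t': "t' < h"
      "n - t = n - t' \<and> m' ! t \<in> P t' \<or> n - t = t' + 1 \<and> bar (m' ! t) \<in> P t'"
      using assms(3) by (auto simp: test_letters_def)
    then have "t' = t" using t hn by linarith
    then show "m' ! t \<in> P t" using t' t hn by auto
    have "zs ! (2 * h - 1 - t) = t + 1" using t by (subst zn) auto
    then have "t + 1 \<in> test_letters n P (m' ! (2 * h - 1 - t))" using *[of "2 * h - 1 - t"] t by auto
    then obtain t' where t': "t' < h" "t + 1 = n - t' \<and> m' ! (2 * h - 1 - t) \<in> P t' \<or>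
        t + 1 = t' + 1 \<and> bar (m' ! (2 * h - 1 - t)) \<in> P t'"
      using assms(3) by (auto simp: test_letters_def)
    then have "t' = t" using t hn by linarith
    then show "bar (m' ! (2 * h - 1 - t)) \<in> P t" using t' t hn by auto
  qed
  then show ?thesis using m' l by blast
qed

section \<open>Comparing a word with its own star\<close>

lemma subseq_word_star: "subseq u v \<Longrightarrow> subseq (word_star n u) (word_star n v)"
  unfolding word_star_def subseq_rev by (rule subseq_map)

lemma word_star_decreasing:
  assumes "sorted_wrt (>) ys" "set ys \<subseteq> {1..n}"
  shows "sorted_wrt (>) (word_star n ys)"
  unfolding word_star_def sorted_wrt_rev sorted_wrt_map
  by (rule sorted_wrt_mono_rel[OF _ assms(1)]) (use assms(2) in fastforce)

lemma dec_in_word_star: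
  assumes "w \<in> lists {1..n}" "dec_in i j d w"
  shows "dec_in (n + 2 - j) (n + 2 - i) d (word_star n w)"
proof -
  obtain ys where ys: "subseq ys w" "sorted_wrt (>) ys" "set ys \<subseteq> {i..<j}" "length ys = d"
    using assms(2) unfolding dec_in_def by auto
  have s: "set ys \<subseteq> {1..n}" using ys(1) assms(1) by (auto dest: list_emb_set)
  have "n + 1 - y \<in> {n + 2 - j..<n + 2 - i}" if "y \<in> set ys" for y
  proof -
    have "i \<le> y" "y < j" "y \<le> n" using that ys(3) s by auto
    then show ?thesis by auto
  qed
  then have "set (word_star n ys) \<subseteq> {n + 2 - j..<n + 2 - i}" by (auto simp: word_star_def)
  moreover have "length (word_star n ys) = d" using ys by (simp add: word_star_def)
  ultimately show ?thesis
    unfolding dec_in_def using subseq_word_star[OF ys(1)] word_star_decreasing[OF ys(2) s] by blast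
qed

lemma dec_in_cap:
  assumes "w \<in> lists {1..n}"
  shows "dec_in i j d w \<longleftrightarrow> dec_in (min i (n + 1)) (min j (n + 1)) d w"
proof -
  have "set ys \<subseteq> {i..<j} \<longleftrightarrow> set ys \<subseteq> {min i (n + 1)..<min j (n + 1)}" if "subseq ys w" for ys
  proof -
    have "set ys \<subseteq> {1..n}" using that assms by (auto dest: list_emb_set)
    then have "y \<in> {i..<j} \<longleftrightarrow> y \<in> {min i (n + 1)..<min j (n + 1)}" if "y \<in> set ys" for y
      using that by (auto dest!: subsetD)
    then show ?thesis by blast
  qed
  then show ?thesis unfolding dec_in_def by blast
qed

text \<open>A decreasing sequence in a symmetric interval is matched by its own mirror image, so only
  fewer than \<open>n\<close> literals matter. If there are as many as \<open>2 * s + 2\<close>, then \<open>n\<close> is odd and one of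
  the two middle literals receives the self-dual letter, hence may be replaced by its star.\<close>

lemma dec_in_lstar:
  assumes f: "\<And>i. f i \<in> lists {1..n}" and n: "n \<ge> 2" "s = (n - 2) div 2"
    and sub: "\<And>m. \<lbrakk>subseq m w; length m \<le> 2 * s + 2\<rbrakk> \<Longrightarrow> subseq m (lstar w) \<or>
      (\<exists>m1 p q m2. m = m1 @ [p, q] @ m2 \<and> length m1 = s \<and> length m2 = s \<and>
        subseq (m1 @ [bar p, q] @ m2) (lstar w) \<and> subseq (m1 @ [p, bar q] @ m2) (lstar w))"
    and dec: "dec_in i j d (subst (word_star n) f w)"
  shows "dec_in i j d (subst (word_star n) f (lstar w))"
proof -
  let ?L = "simg (word_star n) f"
  obtain ys where ys: "sorted_wrt (>) ys" "set ys \<subseteq> {i..<j}" "length ys = d"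
    "subseq ys (subst (word_star n) f w)"
    using dec unfolding dec_in_def by blast
  obtain m yss where ysc: "ys = concat yss"
    and m: "subseq m w" "list_all2 (\<lambda>z p. z \<noteq> [] \<and> subseq z (?L p)) yss m"
    using ys(4) unfolding subst_def subseq_concat_map by blast
  have yn: "set ys \<subseteq> {1..n}" using ys(4) subst_lists[of f n w, OF f] by (auto dest: list_emb_set)
  define a b where "a = max i 1" and "b = min j (n + 1)"
  have yab: "set ys \<subseteq> {a..<b}" using yn ys(2) by (auto simp: a_def b_def dest!: subsetD)
  have ij: "{a..<b} \<subseteq> {i..<j}" by (auto simp: a_def b_def)
  have goal: ?thesis if "subseq zs (subst (word_star n) f (lstar w))" "sorted_wrt (>) zs"
    "set zs \<subseteq> {a..<b}" "length zs = d" for zs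
    using that ij unfolding dec_in_def by blast
  have distinct: "length ys \<le> b - a"
  proof -
    have "distinct (rev ys)" using ys(1) strict_sorted_iff[of "rev ys"]
       by (simp add: sorted_wrt_rev)
    then have "length ys = card (set ys)" by (simp add: distinct_card)
    also have "\<dots> \<le> card {a..<b}" by (rule card_mono) (simp_all add: yab)
    finally show ?thesis by simp
  qed
  show ?thesis
  proof (cases "a + b = n + 2")
    case True
    show ?thesis
    proof (rule goal)
      show "subseq (word_star n ys) (subst (word_star n) f (lstar w))"
        unfolding subst_word_star_lstar[OF f] by (rule subseq_word_star[OF ys(4)])
      show "sorted_wrt (>) (word_star n ys)" by (rule word_star_decreasing[OF ys(1) yn])
      have "n + 1 - y \<in> {a..<b}" if "y \<in> set ys" for y
        using that yab True by (auto dest!: subsetD)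
      then show "set (word_star n ys) \<subseteq> {a..<b}" by (auto simp: word_star_def)
    qed (simp add: word_star_def ys(3))
  next
    case False
    then have ba: "b - a \<le> n - 1" by (auto simp: a_def b_def)
    have lm: "length yss = length m" using m(2) by (rule list_all2_lengthD)
    have ne: "[] \<notin> set yss" using m(2) by (auto simp: list_all2_conv_all_nth in_set_conv_nth)
    have "length m \<le> length ys" using length_le_concat[OF ne] lm ysc by simp
    then have "length m \<le> 2 * s + 2" using distinct ba n by linarith
    from sub[OF m(1) this] show ?thesis
    proof (elim disjE exE conjE)
      assume "subseq m (lstar w)"
      then have "subseq ys (subst (word_star n) f (lstar w))"
        unfolding subst_def subseq_concat_map using m(2) ysc by blast
      then show ?thesis using ys yab by (intro goal) auto
    next
      fix m1 p q m2
      assume mm: "m = m1 @ [p, q] @ m2" "length m1 = s" "length m2 = s"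
        and sp: "subseq (m1 @ [bar p, q] @ m2) (lstar w)" and sq: "subseq (m1 @ [p, bar q] @ m2) (lstar w)"
      have lm2: "length m = 2 * s + 2" using mm by simp
      then have n3: "n = 2 * s + 3" and lys: "length ys = n - 1" and ban: "b - a = n - 1"
        using \<open>length m \<le> length ys\<close> distinct ba n by linarith+
      have one: "yss = map (\<lambda>y. [y]) ys"
        unfolding ysc using lys lm lm2 n3 ysc by (intro concat_singletons[OF ne]) auto
      have ysm: "list_all2 (\<lambda>y p. y \<in> set (?L p)) ys m"
        using m(2) unfolding one by (simp add: list_all2_map1 subseq_singleton_left)
      have "ys = rev [a..<b]"
        using lys ban yab ys(1) by (intro decreasing_unique) (auto simp: sorted_wrt_rev)
      then have yt: "ys ! t = b - 1 - t" if "t < n - 1" for t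
        using that ban by (simp add: rev_nth)
      have mirror: "s + 2 \<in> set (?L (bar r))" if "s + 2 \<in> set (?L r)" for r
        using that n3 unfolding simg_bar_word_star[OF f] by (auto simp: word_star_def intro!: image_eqI)
      have upd: "list_all2 (\<lambda>y p. y \<in> set (?L p)) ys (m[t := bar (m ! t)])"
        if "t < length m" "ys ! t = s + 2" for t
        using ysm that mirror[of "m ! t"] by (auto simp: list_all2_conv_all_nth nth_list_update)
      have fin: ?thesis if "list_all2 (\<lambda>y p. y \<in> set (?L p)) ys m'" "subseq m' (lstar w)" for m'
      proof (rule goal)
        have "list_all2 (\<lambda>z p. z \<noteq> [] \<and> subseq z (?L p)) yss m'"
          using that(1) unfolding one by (simp add: list_all2_map1 subseq_singleton_left)
        then show "subseq ys (subst (word_star n) f (lstar w))"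
          unfolding subst_def subseq_concat_map using that(2) ysc by blast
      qed (use ys yab in auto)
      \<comment> \<open>An interval of \<open>n - 1\<close> letters misses 1 or \<open>n\<close>.
        Accordingly the self-dual letter \<open>s + 2\<close> is taken at the second or at the first
        of the two middle positions.\<close>
      have "a = 2 \<and> b = n + 1 \<or> a = 1 \<and> b = n"
        using ban n3 False unfolding a_def b_def by linarith
      then show ?thesis
      proof (elim disjE conjE)
        assume "a = 2" "b = n + 1"
        then have "ys ! Suc s = s + 2" using n3 by (subst yt) auto
        from upd[OF _ this] have "list_all2 (\<lambda>y p. y \<in> set (?L p)) ys (m1 @ [p, bar q] @ m2)"
          using mm by (simp add: list_update_append nth_append)
        from fin[OF this sq] show ?thesis .
      next
        assume "a = 1" "b = n"
        then have "ys ! s = s + 2" using n3 by (subst yt) auto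
        from upd[OF _ this] have "list_all2 (\<lambda>y p. y \<in> set (?L p)) ys (m1 @ [bar p, q] @ m2)"
          using mm by (simp add: list_update_append nth_append)
        from fin[OF this sp] show ?thesis .
      qed
    qed
  qed
qed

text \<open>One implication suffices for \<open>dec_in_imp_styl\<close>; the converse is its mirror
  image under \<open>word_star n\<close>.\<close>

lemma holds_lstarI:
  assumes n: "n \<ge> 2" "s = (n - 2) div 2"
    and sub: "\<And>m. \<lbrakk>subseq m w; length m \<le> 2 * s + 2\<rbrakk> \<Longrightarrow> subseq m (lstar w) \<or>
      (\<exists>m1 p q m2. m = m1 @ [p, q] @ m2 \<and> length m1 = s \<and> length m2 = s \<and>
        subseq (m1 @ [bar p, q] @ m2) (lstar w) \<and> subseq (m1 @ [p, bar q] @ m2) (lstar w))"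
  shows "holds n w (lstar w)"
  unfolding holds_def
proof (intro allI impI)
  fix f :: "nat \<Rightarrow> nat list"
  assume "\<forall>i. f i \<in> lists {1..n}"
  then have f: "\<And>i. f i \<in> lists {1..n}" by blast
  let ?u = "subst (word_star n) f w" and ?v = "subst (word_star n) f (lstar w)"
  have uv: "?v = word_star n ?u" by (rule subst_word_star_lstar[OF f])
  have u: "?u \<in> lists {1..n}" and v: "?v \<in> lists {1..n}" by (rule subst_lists[OF f])+
  have vu: "word_star n ?v = ?u" unfolding uv by (rule word_star_word_star[OF u])
  show "(?u, ?v) \<in> styl_cong n"
  proof (rule dec_in_imp_styl[OF u v])
    fix i j d
    have 1: "dec_in i j d ?v" if "dec_in i j d ?u" for i j d
      using dec_in_lstar[OF f n sub that] .
    show "dec_in i j d ?u \<longleftrightarrow> dec_in i j d ?v"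
    proof
      assume "dec_in i j d ?v"
      \<comment> \<open>Subtraction is truncated, so reflecting an interval twice restores it only
        for small endpoints; capping them at \<open>n + 1\<close> ensures this.\<close>
      then have "dec_in (min i (n + 1)) (min j (n + 1)) d ?v" using dec_in_cap[OF v] by blast
      from dec_in_word_star[OF v this, unfolded vu, THEN 1, THEN dec_in_word_star[OF v], unfolded vu]
      have "dec_in (min i (n + 1)) (min j (n + 1)) d ?u" by simp
      then show "dec_in i j d ?u" using dec_in_cap[OF u] by blast
    qed (rule 1)
  qed
qed


section \<open>The critical identities\<close>

definition Xs :: "nat \<Rightarrow> lit list" where
  "Xs k = rev (map (Pair False) [0..<Suc k])"

text \<open>The last block lacks \<open>Xs k\<close>. This keeps increasing runs of \<open>s\<close>
  variables away from the last \<open>z\<close>, but still admits every pattern of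
  \<open>s - 1\<close> of its literals followed by a starred one of index at most
  \<open>k\<close>.\<close>

definition left_word :: "nat \<Rightarrow> nat \<Rightarrow> lit list" where
  "left_word s k = (if s = 0 then [] else
     concat (replicate (s - 1) (Xs k @ lstar (Xs k) @ [(False, Suc k)])) @ lstar (Xs k) @ [(False, Suc k)])"

text \<open>This is \<open>x_1 x_0* x_2 x_1* x_3 x_2* ...\<close>: the interval from
  \<open>x_a\<close> to \<open>x_a*\<close> overlaps the next one and ends before \<open>x_b\<close>
  with \<open>b = a + 2\<close>.\<close>

definition core :: "nat \<Rightarrow> lit list" where
  "core k = concat (map (\<lambda>i. [(False, Suc i), (True, i)]) [0..<k])"

text \<open>The star exchanges the two flanks, so \<open>mid k\<close> and its star differ only in
  the core. Three copies suffice for the patterns reaching the middle in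
  \<open>crit_subseqs\<close>.\<close>

definition mid :: "nat \<Rightarrow> lit list" where
  "mid k = concat (replicate 3 (Xs k)) @ core k @ concat (replicate 3 (lstar (Xs k)))"

definition crit :: "nat \<Rightarrow> nat \<Rightarrow> lit list" where
  "crit s k = left_word s k @ mid k @ lstar (left_word s k)"

lemma set_Xs [simp]: "set (Xs k) = Pair False ` {..k}"
  by (auto simp: Xs_def)

lemma bar_Xs: "bar ` Pair False ` A = Pair True ` A"
  by (simp add: image_image)

lemma set_core: "set (core k) \<subseteq> Pair False ` {..k} \<union> Pair True ` {..k}"
  by (auto simp: core_def)

lemma lstar_replicate: "lstar (concat (replicate r u)) = concat (replicate r (lstar u))"
proof (induction r)
  case (Suc r)
  have "concat (replicate r v) @ v = v @ concat (replicate r v)" for v :: "lit list"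
    by (induction r) auto
  then show ?case using Suc by simp
qed simp

lemma lstar_replicate_single [simp]: "lstar (replicate r p) = replicate r (bar p)"
  by (simp add: lstar_def)

lemma lstar_mid:
  "lstar (mid k) = concat (replicate 3 (Xs k)) @ lstar (core k) @ concat (replicate 3 (lstar (Xs k)))"
  by (simp add: mid_def lstar_replicate)

lemma lstar_crit: "lstar (crit s k) = left_word s k @ lstar (mid k) @ lstar (left_word s k)"
  by (simp add: crit_def)

lemma set_mid: "set (mid k) \<subseteq> Pair False ` {..k} \<union> Pair True ` {..k}"
  using set_core[of k] by (auto simp: mid_def bar_Xs)

lemma set_left_word:
  "set (left_word s k) \<subseteq> Pair False ` {..k} \<union> Pair True ` {..k} \<union> {(False, Suc k)}"
  by (auto simp: left_word_def bar_Xs)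

lemma subseq_universal:
  "\<lbrakk>set m \<subseteq> set w; length m \<le> r\<rbrakk> \<Longrightarrow> subseq m (concat (replicate r w))"
proof (induction m arbitrary: r)
  case (Cons p m)
  then obtain r' where r: "r = Suc r'" by (cases r) auto
  have "subseq ([p] @ m) (w @ concat (replicate r' w))"
    using Cons r by (intro list_emb_append_mono) (auto simp: subseq_singleton_left)
  then show ?case using r by simp
qed simp

text \<open>The complete blocks contain all patterns of \<open>s - 1\<close> literals, and the
  incomplete last block can still take a starred one.\<close>

lemma left_word_extend:
  assumes "subseq m (left_word s k)" "p \<in> Pair False ` {..k} \<union> Pair True ` {..k}"
    "\<not> subseq (m @ [p]) (left_word s k)"
  shows "s \<le> length m \<or> (Suc (length m) = s \<and> \<not> fst p)"
proof (rule ccontr)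
  assume *: "\<not> ?thesis"
  then obtain r where s: "s = Suc r" by (cases s) auto
  let ?w = "Xs k @ lstar (Xs k) @ [(False, Suc k)]"
  have L: "left_word s k = concat (replicate r ?w) @ lstar (Xs k) @ [(False, Suc k)]"
    unfolding s left_word_def by simp
  have "set m \<subseteq> set (left_word s k)" using assms(1) by (auto dest: list_emb_set)
  then have m: "set m \<subseteq> set ?w" using set_left_word[of s k] by (auto simp: bar_Xs)
  show False
  proof (cases "length m < r")
    case True
    then have "subseq (m @ [p]) (concat (replicate r ?w))"
      using m assms(2) by (intro subseq_universal) (auto simp: bar_Xs)
    then show False using assms(3) unfolding L by (auto intro: subseq_rev_drop_many)
  next
    case False
    then have "length m = r" "fst p" using * s by auto
    then have "p \<in> set (lstar (Xs k))" using assms(2) by (auto simp: bar_Xs)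
    then have "subseq (m @ [p]) (concat (replicate r ?w) @ (lstar (Xs k) @ [(False, Suc k)]))"
      using m \<open>length m = r\<close> by (intro list_emb_append_mono subseq_universal)
        (auto simp: subseq_singleton_left)
    then show False using assms(3) unfolding L by simp
  qed
qed

lemma descent_or_sorted:
  "(\<exists>a p q b. m = a @ [p, q] @ b \<and> fst p \<and> \<not> fst q) \<or>
   (\<exists>U S. (m :: lit list) = U @ S \<and> (\<forall>p\<in>set U. \<not> fst p) \<and> (\<forall>p\<in>set S. fst p))"
proof (induction m)
  case (Cons r m)
  from Cons show ?case
  proof (elim disjE exE conjE)
    fix a p q b assume "m = a @ [p, q] @ b" "fst p" "\<not> fst q"
    then show ?thesis by (intro disjI1 exI[of _ "r # a"]) auto
  next
    fix U S assume US: "m = U @ S" "\<forall>p\<in>set U. \<not> fst p" "\<forall>p\<in>set S. fst p"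
    show ?thesis
    proof (cases "fst r")
      case False
      then show ?thesis using US by (intro disjI2 exI[of _ "r # U"] exI[of _ S]) auto
    next
      case True
      show ?thesis
      proof (cases U)
        case Nil
        then show ?thesis using US True by (intro disjI2 exI[of _ "[]"] exI[of _ "r # S"]) auto
      next
        case (Cons u U')
        then show ?thesis using US True
          by (intro disjI1 exI[of _ "[]"] exI[of _ r] exI[of _ u] exI[of _ "U' @ S"]) auto
      qed
    qed
  qed
qed auto

lemma sorted_subseq_lstar_mid:
  assumes "set U \<subseteq> Pair False ` {..k}" "set S \<subseteq> Pair True ` {..k}" "length U \<le> 3" "length S \<le> 3"
  shows "subseq (U @ S) (lstar (mid k))"
proof -
  have "subseq S (concat (replicate 3 (lstar (Xs k))))"
    using assms by (intro subseq_universal) (auto simp: bar_Xs)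
  then have "subseq S (lstar (core k) @ concat (replicate 3 (lstar (Xs k))))"
    by (rule subseq_drop_many)
  then show ?thesis
    unfolding lstar_mid using assms by (intro list_emb_append_mono subseq_universal) auto
qed

text \<open>Among all embeddings of \<open>m\<close>, take one with the shortest part
  \<open>m'\<close> inside \<open>mid k\<close>. Its ends cannot be moved outwards, so
  \<open>left_word_extend\<close> makes the outer parts long and \<open>m'\<close> short. Without a
  descent from starred to unstarred, \<open>m'\<close> fits into the flanks of \<open>mid k\<close>.
  A descent \<open>p, q\<close> leaves exactly \<open>s\<close> literals on either side, and
  starring one of \<open>p\<close>, \<open>q\<close> removes it.\<close>

lemma crit_subseqs:
  assumes m: "subseq m (crit s k)" "length m \<le> 2 * s + 2"
  shows "subseq m (lstar (crit s k)) \<or>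
      (\<exists>m1 p q m2. m = m1 @ [p, q] @ m2 \<and> length m1 = s \<and> length m2 = s \<and>
        subseq (m1 @ [bar p, q] @ m2) (lstar (crit s k)) \<and>
        subseq (m1 @ [p, bar q] @ m2) (lstar (crit s k)))"
proof -
  let ?L = "left_word s k" and ?A = "Pair False ` {..k} :: lit set" and ?B = "Pair True ` {..k} :: lit set"
  define P where "P = (\<lambda>l. \<exists>m0 m' m2. m = m0 @ m' @ m2 \<and> subseq m0 ?L \<and> subseq m' (mid k) \<and>
    subseq m2 (lstar ?L) \<and> length m' = l)"
  have "\<exists>l. P l"
    using m(1) unfolding P_def crit_def subseq_append_iff by blast
  then have "P (LEAST l. P l)" by (rule LeastI_ex)
  then obtain m0 m' m2 where mm: "m = m0 @ m' @ m2" "subseq m0 ?L" "subseq m' (mid k)" "subseq m2 (lstar ?L)"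
    and l: "length m' = (LEAST l. P l)"
    by (subst (asm) (1) P_def) (elim exE conjE, blast)
  have least: "length m' \<le> length n'"
    if "m = n0 @ n' @ n2" "subseq n0 ?L" "subseq n' (mid k)" "subseq n2 (lstar ?L)" for n0 n' n2
  proof -
    have "P (length n')" unfolding P_def using that by blast
    then show ?thesis unfolding l by (rule Least_le)
  qed
  have "set m' \<subseteq> set (mid k)" using mm(3) by (auto dest: list_emb_set)
  then have AB: "set m' \<subseteq> ?A \<union> ?B" using set_mid[of k] by blast
  have I: "subseq (m0 @ w @ m2) (lstar (crit s k))" if "subseq w (lstar (mid k))" for w
    unfolding lstar_crit using mm that by (intro list_emb_append_mono)
  show ?thesis
  proof (cases "m' = []")
    case True
    then show ?thesis using I[of "[]"] mm by simp
  next
    case False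
    have l0: "s \<le> length m0 \<or> (Suc (length m0) = s \<and> \<not> fst (hd m'))"
    proof (rule left_word_extend[OF mm(2)])
      show "hd m' \<in> ?A \<union> ?B" using AB False by (meson hd_in_set subsetD)
      show "\<not> subseq (m0 @ [hd m']) ?L"
      proof
        assume "subseq (m0 @ [hd m']) ?L"
        moreover have "subseq (tl m') (mid k)" using mm(3) False by (metis list.collapse subseq_Cons')
        ultimately have "length m' \<le> length (tl m')" using mm False by (intro least[of "m0 @ [hd m']" _ m2]) auto
        then show False using False by (cases m') auto
      qed
    qed
    have l2: "s \<le> length (lstar m2) \<or> (Suc (length (lstar m2)) = s \<and> \<not> fst (bar (last m')))"
    proof (rule left_word_extend[where k = k])
      show "subseq (lstar m2) ?L" using mm(4) subseq_lstar by blast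
      have "last m' \<in> ?A \<union> ?B" using AB False by (meson last_in_set subsetD)
      then show "bar (last m') \<in> ?A \<union> ?B" by auto
      show "\<not> subseq (lstar m2 @ [bar (last m')]) ?L"
      proof
        assume "subseq (lstar m2 @ [bar (last m')]) ?L"
        then have "subseq (last m' # m2) (lstar ?L)" unfolding subseq_lstar by simp
        moreover have "subseq (butlast m') (mid k)"
          using mm(3) False by (metis append_butlast_last_id list_emb_append_mono list_emb_refl prefix_imp_subseq prefixI subseq_order.trans)
        moreover have "m = m0 @ butlast m' @ last m' # m2"
          using mm(1) False by (metis append.assoc append_Cons append_Nil append_butlast_last_id)
        ultimately have "length m' \<le> length (butlast m')" using mm by (intro least) auto
        then show False using False by (cases "length m'") auto
      qed
    qed
    have l2: "s \<le> length m2 \<or> (Suc (length m2) = s \<and> fst (last m'))"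
      using l2 by (simp add: bar_def)
    have len: "length m0 + length m' + length m2 \<le> 2 * s + 2" using m(2) mm(1) by simp
    from descent_or_sorted[of m'] show ?thesis
    proof (elim disjE exE conjE)
      fix a p q b assume d: "m' = a @ [p, q] @ b" "fst p" "\<not> fst q"
      have a: "s \<le> length m0 \<or> (Suc (length m0) = s \<and> a \<noteq> [] \<and> \<not> fst (hd a))"
        using l0 d by (cases a) auto
      have b: "s \<le> length m2 \<or> (Suc (length m2) = s \<and> b \<noteq> [] \<and> fst (last b))"
        using l2 d by (cases b rule: rev_cases) auto
      have a1: "length a > 0" if "a \<noteq> []" using that by simp
      have b1: "length b > 0" if "b \<noteq> []" using that by simp
      have l1: "length (m0 @ a) = s" "length (b @ m2) = s"
        using a b len d a1 b1 by (auto; linarith)+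
      have "set a \<subseteq> ?A \<and> length a \<le> 1"
      proof (cases a)
        case (Cons x a')
        then have "length a' = 0" "\<not> fst x" using a l1 by (simp_all del: length_0_conv)
        then have "a' = []" by simp
        with \<open>\<not> fst x\<close> show ?thesis using Cons AB d by auto
      qed simp
      moreover have "set b \<subseteq> ?B \<and> length b \<le> 1"
      proof (cases b rule: rev_cases)
        case (snoc b' x)
        then have "length b' = 0" "fst x" using b l1 by (simp_all del: length_0_conv)
        then have "b' = []" by simp
        with \<open>fst x\<close> show ?thesis using snoc AB d by auto
      qed simp
      moreover have "p \<in> ?B" "q \<in> ?A" using AB d by auto
      ultimately have "subseq ((a @ [bar p, q]) @ b) (lstar (mid k))" "subseq (a @ [p, bar q] @ b) (lstar (mid k))"
        by (intro sorted_subseq_lstar_mid; auto)+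
      from this[THEN I] show ?thesis
        using l1 mm d by (intro disjI2 exI[of _ "m0 @ a"] exI[of _ p] exI[of _ q] exI[of _ "b @ m2"]) simp
    next
      fix U S assume US: "m' = U @ S" "\<forall>p\<in>set U. \<not> fst p" "\<forall>p\<in>set S. fst p"
      \<comment> \<open>Length 4 forces both outer parts to have length \<open>s - 1\<close>. Then
        \<open>m'\<close> begins unstarred and ends starred, so neither \<open>U\<close> nor
        \<open>S\<close> takes all four.\<close>
      have l4: "length m' \<le> 4" using l0 l2 len by auto
      have "length U \<le> 3"
      proof (rule ccontr)
        assume U: "\<not> length U \<le> 3"
        have "length S = 0" using l4 U unfolding US by (simp only: length_append)
        moreover have "U \<noteq> []" using U by auto
        moreover have "length m2 < s" using l0 l2 len US U by auto
        ultimately have "fst (last m')" "last m' \<in> set U" using l2 US U by auto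
        then show False using US by auto
      qed
      moreover have "length S \<le> 3"
      proof (rule ccontr)
        assume U: "\<not> length S \<le> 3"
        have "length U = 0" using l4 U unfolding US by (simp only: length_append)
        moreover have "S \<noteq> []" using U by auto
        moreover have "length m0 < s" using l0 l2 len US U by auto
        ultimately have "\<not> fst (hd m')" "hd m' \<in> set S" using l0 US U by auto
        then show False using US by auto
      qed
      moreover have "x \<in> ?A" if "x \<in> set U" for x
      proof -
        have "x \<in> ?A \<union> ?B" using AB US(1) that by auto
        then show ?thesis using US(2) that by auto
      qed
      then have "set U \<subseteq> ?A" by blast
      moreover have "x \<in> ?B" if "x \<in> set S" for x
      proof -
        have "x \<in> ?A \<union> ?B" using AB US(1) that by auto
        then show ?thesis using US(3) that by auto
      qed
      then have "set S \<subseteq> ?B" by blast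
      ultimately have "subseq m' (lstar (mid k))" unfolding US by (intro sorted_subseq_lstar_mid)
      then show ?thesis using I mm by simp
    qed
  qed
qed

lemma holds_crit: "n \<ge> 2 \<Longrightarrow> holds n (crit ((n - 2) div 2) k) (lstar (crit ((n - 2) div 2) k))"
  by (rule holds_lstarI[OF _ HOL.refl crit_subseqs])

section \<open>Framed tests and forbidden runs\<close>

text \<open>Test words \<open>z\<^sup>s m z\<^sup>*\<^sup>s\<close>: the powers of \<open>z\<close> confine \<open>m\<close> to the middle part.\<close>

definition framed :: "nat \<Rightarrow> nat \<Rightarrow> lit list \<Rightarrow> lit list" where
  "framed s k m = replicate s (False, Suc k) @ m @ replicate s (True, Suc k)"

lemma lstar_framed: "lstar (framed s k m) = framed s k (lstar m)"
  by (simp add: framed_def)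

lemma subseq_replicate_iff: "subseq (replicate r p) w \<longleftrightarrow> r \<le> length (filter (\<lambda>q. q = p) w)"
proof
  assume "subseq (replicate r p) w"
  then have "subseq (filter (\<lambda>q. q = p) (replicate r p)) (filter (\<lambda>q. q = p) w)"
    by (rule subseq_filter)
  then show "r \<le> length (filter (\<lambda>q. q = p) w)"
    using not_subseq_length[of "filter (\<lambda>q. q = p) w" "replicate r p"] by force
next
  have "filter (\<lambda>q. q = p) w = replicate (length (filter (\<lambda>q. q = p) w)) p"
    by (induction w) auto
  moreover assume "r \<le> length (filter (\<lambda>q. q = p) w)"
  then obtain t where "length (filter (\<lambda>q. q = p) w) = t + r" by (metis add.commute le_Suc_ex)
  ultimately have "filter (\<lambda>q. q = p) w = replicate t p @ replicate r p"
    by (simp add: replicate_add)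
  then show "subseq (replicate r p) w"
    using subseq_filter_left[of "\<lambda>q. q = p" w] by (metis subseq_drop_many subseq_order.order_refl subseq_order.trans)
qed

lemma filter_left_word [simp]:
  "filter (\<lambda>q. q = (False, Suc k)) (left_word s k) = replicate s (False, Suc k)"
proof -
  have X: "filter (\<lambda>q. q = (False, Suc k)) (Xs k) = []" "filter (\<lambda>q. q = (False, Suc k)) (lstar (Xs k)) = []"
    by (auto simp: filter_empty_conv)
  have "filter (\<lambda>q. q = (False, Suc k)) (concat (replicate r (Xs k @ lstar (Xs k) @ [(False, Suc k)]))) =
    replicate r (False, Suc k)" for r
    by (induction r) (auto simp: X)
  then show ?thesis
    by (cases s) (auto simp: left_word_def X simp flip: replicate_append_same)
qed

text \<open>The word \<open>left_word s k\<close> has exactly \<open>s\<close> letters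
  \<open>z\<close> and, if nonempty, ends with one; matching all of them exhausts it.\<close>

lemma left_word_strip:
  assumes "subseq (replicate s (False, Suc k) @ m) (left_word s k @ v)"
    "(False, Suc k) \<notin> set m" "(False, Suc k) \<notin> set v"
  shows "subseq m v"
proof -
  let ?z = "(False, Suc k) :: lit"
  obtain x1 x2 where x: "replicate s ?z @ m = x1 @ x2" "subseq x1 (left_word s k)" "subseq x2 v"
    using assms(1) by (auto simp: subseq_append_iff)
  have "?z \<notin> set x2" using x(3) assms(3) by (auto dest: list_emb_set)
  have "length (filter (\<lambda>q. q = ?z) (replicate s ?z @ m)) = s"
    using assms(2) by (simp add: filter_empty_conv filter_replicate)
       (metis (mono_tags, lifting) filter_False)
  moreover have "filter (\<lambda>q. q = ?z) x2 = []" using \<open>?z \<notin> set x2\<close> by (auto simp: filter_empty_conv)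
  ultimately have c: "length (filter (\<lambda>q. q = ?z) x1) = s" unfolding x(1) by simp
  then have "s \<le> length x1" using length_filter_le[of "\<lambda>q. q = ?z" x1] by simp
  then have x1: "x1 = replicate s ?z @ take (length x1 - s) m"
    using arg_cong[OF x(1), of "take (length x1)"] by simp
  define m' where "m' = take (length x1 - s) m"
  have m': "x1 = replicate s ?z @ m'" using x1 unfolding m'_def .
  with x(1) have m2: "m = m' @ x2" by simp
  have "m' = []"
  proof (cases s)
    case 0
    then show ?thesis using x(2) m' by (simp add: left_word_def)
  next
    case (Suc r)
    then obtain L where L: "left_word s k = L @ [?z]" by (simp add: left_word_def)
    show ?thesis
    proof (rule ccontr)
      assume ne: "m' \<noteq> []"
      then have "last m' \<noteq> ?z" using assms(2) m2 by (metis UnI1 last_in_set set_append)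
      moreover have "x1 \<noteq> []" "last x1 = last m'" using ne m' by auto
      then have "rev x1 = last m' # rev (butlast x1)"
        by (metis append_butlast_last_id rev.simps(2) rev_rev_ident rev_swap)
      moreover have "subseq (rev x1) (?z # rev L)"
        using x(2) unfolding L subseq_rev[of x1, symmetric] by simp
      ultimately have "subseq (rev x1) (rev L)" by (metis subseq_Cons2_neq)
      then have "subseq x1 L" by (simp only: subseq_rev)
      then have "subseq (filter (\<lambda>q. q = ?z) x1) (filter (\<lambda>q. q = ?z) L)" by (rule subseq_filter)
      then have "s \<le> length (filter (\<lambda>q. q = ?z) L)" using c not_subseq_length by (metis not_le)
      moreover have "length (filter (\<lambda>q. q = ?z) (L @ [?z])) = s" unfolding L[symmetric] by simp
      ultimately show False by simp
    qed
  qed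
  then show ?thesis using m2 x by simp
qed

lemma z_notin:
  "(b, Suc k) \<notin> set (mid k)" "(b, Suc k) \<notin> set (lstar (mid k))"
  "(True, Suc k) \<notin> set (left_word s k)" "(False, Suc k) \<notin> set (lstar (left_word s k))"
  using set_mid[of k] set_left_word[of s k] by (auto simp: bar_def)

lemma framed_iff:
  assumes "(False, Suc k) \<notin> set m" "(True, Suc k) \<notin> set m" "(False, Suc k) \<notin> set v" "(True, Suc k) \<notin> set v"
  shows "subseq (framed s k m) (left_word s k @ v @ lstar (left_word s k)) \<longleftrightarrow> subseq m v"
proof
  assume "subseq (framed s k m) (left_word s k @ v @ lstar (left_word s k))"
  then have "subseq (m @ replicate s (True, Suc k)) (v @ lstar (left_word s k))"
    unfolding framed_def using assms z_notin(4) by (elim left_word_strip) auto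
  then have "subseq (lstar (m @ replicate s (True, Suc k))) (lstar (v @ lstar (left_word s k)))"
    by (rule subseq_lstar_imp)
  then have "subseq (replicate s (False, Suc k) @ lstar m) (left_word s k @ lstar v)" by simp
  then have "subseq (lstar m) (lstar v)"
    using assms by (elim left_word_strip) (auto simp: bar_def)
  then show "subseq m v" using subseq_lstar by fastforce
next
  have *: "subseq (replicate s (False, Suc k)) (left_word s k)" by (simp add: subseq_replicate_iff)
  from subseq_lstar_imp[OF this] have "subseq (replicate s (True, Suc k)) (lstar (left_word s k))" by simp
  with * show "subseq (framed s k m) (left_word s k @ v @ lstar (left_word s k))" if "subseq m v"
    using that unfolding framed_def by (intro list_emb_append_mono)
qed

lemma framed_crit:
  assumes "snd ` set m \<subseteq> {..k}"
  shows "subseq (framed s k m) (crit s k) \<longleftrightarrow> subseq m (mid k)"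
    "subseq (framed s k m) (lstar (crit s k)) \<longleftrightarrow> subseq m (lstar (mid k))"
proof -
  have "(b, Suc k) \<notin> set m" for b using assms by force
  then show "subseq (framed s k m) (crit s k) \<longleftrightarrow> subseq m (mid k)"
    "subseq (framed s k m) (lstar (crit s k)) \<longleftrightarrow> subseq m (lstar (mid k))"
    unfolding lstar_crit unfolding crit_def by (intro framed_iff z_notin; blast)+
qed

lemma subseq_set: "subseq u v \<Longrightarrow> set u \<subseteq> set v"
  by (auto elim: list_emb_set)

text \<open>In the core, \<open>x_b\<close> occurs only in the block with index \<open>b - 1\<close>
  and \<open>x_a*\<close> only in that with index \<open>a\<close>.\<close>

lemma subseq_pair_core: "subseq [(True, a), (False, b)] (core k) \<longleftrightarrow> a + 2 \<le> b \<and> b \<le> k"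
proof (induction k)
  case (Suc k)
  have "(True, a) \<in> set (core k) \<longleftrightarrow> a < k" by (auto simp: core_def)
  moreover have "(False, b) \<in> set [(False, Suc k), (True, k)] \<longleftrightarrow> b = Suc k" by auto
  moreover have "core (Suc k) = core k @ [(False, Suc k), (True, k)]" by (simp add: core_def)
  moreover have "subseq [p, q] (u @ [(False, Suc k), (True, k)]) \<longleftrightarrow> subseq [p, q] u \<or>
      (p \<in> set u \<and> q \<in> set [(False, Suc k), (True, k)]) \<or> subseq [p, q] [(False, Suc k), (True, k)]" for u p q
    unfolding subseq_append_iff subseq_singleton_left[symmetric]
    by (auto simp: Cons_eq_append_conv; metis)
  ultimately show ?case using Suc by auto
qed (simp add: core_def)

lemma subseq_pair_mid:
  assumes "b \<le> k"
  shows "subseq [(True, a), (False, b)] (mid k) \<longleftrightarrow> a + 2 \<le> b"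
proof -
  have "subseq [(True, a), (False, b)] (core k)" if "subseq [(True, a), (False, b)] (mid k)"
  proof -
    from that obtain x1 x2 x3 where x: "[(True, a), (False, b)] = x1 @ x2 @ x3"
      "subseq x1 (concat (replicate 3 (Xs k)))" "subseq x2 (core k)"
      "subseq x3 (concat (replicate 3 (lstar (Xs k))))"
      unfolding mid_def subseq_append_iff by blast
    have "set x1 \<subseteq> Pair False ` {..k}" "set x3 \<subseteq> Pair True ` {..k}"
      using subseq_set[OF x(2)] subseq_set[OF x(4)] by (auto simp: bar_Xs)
    then have "x1 = []" "x3 = []" using x(1)
      by (auto simp: Cons_eq_append_conv append_eq_Cons_conv)
    then show ?thesis using x by simp
  qed
  moreover have "subseq m (mid k)" if "subseq m (core k)" for m
    unfolding mid_def using that by (intro subseq_drop_many subseq_rev_drop_many)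
  ultimately show ?thesis using assms by (auto simp: subseq_pair_core)
qed

text \<open>The indices decrease in every \<open>Xs k\<close>, so each of the \<open>s - 1\<close> copies in front of the last
  \<open>z\<close> contains at most one entry of an increasing run.\<close>

definition run :: "nat \<Rightarrow> nat \<Rightarrow> lit list" where
  "run c r = map (Pair False) [c..<c + r]"

lemma run_not_subseq:
  assumes "s > 0" "c + s \<le> Suc k"
  shows "\<not> subseq (run c s @ [(False, Suc k)]) (crit s k)"
proof
  let ?z = "(False, Suc k) :: lit" and ?P = "\<lambda>p :: lit. \<not> fst p \<and> snd p \<le> k"
  assume "subseq (run c s @ [?z]) (crit s k)"
  then obtain x1 x2 where x: "run c s @ [?z] = x1 @ x2" "subseq x1 (left_word s k)"
    "subseq x2 (mid k @ lstar (left_word s k))"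
    unfolding crit_def by (auto simp: subseq_append_iff)
  have "?z \<notin> set x2" using x(3) z_notin(1,4) by (auto dest: list_emb_set)
  then have "x2 = []" using x(1) by (cases x2 rule: rev_cases) auto
  then have "subseq (run c s @ [?z]) (left_word s k)" using x by simp
  \<comment> \<open>Discarding \<open>z\<close> and all starred literals leaves \<open>s - 1\<close>
    copies of \<open>Xs k\<close>.\<close>
  then have "subseq (filter ?P (run c s @ [?z])) (filter ?P (left_word s k))" by (rule subseq_filter)
  moreover have "filter ?P (run c s @ [?z]) = run c s"
    using assms by (auto simp: run_def)
  moreover have X: "filter ?P (Xs k) = Xs k" "filter ?P (lstar (Xs k)) = []"
    by (auto simp: filter_id_conv filter_empty_conv)
  have "filter ?P (concat (replicate r (Xs k @ lstar (Xs k) @ [?z]))) = concat (replicate r (Xs k))" for r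
    by (induction r) (auto simp: X)
  then have "filter ?P (left_word s k) = concat (replicate (s - 1) (Xs k))"
    using assms by (simp add: left_word_def X)
  ultimately have "subseq (run c s) (concat (replicate (s - 1) (Xs k)))" by simp
  moreover have "length I \<le> r"
    if "subseq I (concat (replicate r (Xs k)))" "sorted_wrt (\<lambda>p q. snd p < snd q) I" for I r
    using that
  proof (induction r arbitrary: I)
    case (Suc r)
    then obtain I1 I2 where I: "I = I1 @ I2" "subseq I1 (Xs k)" "subseq I2 (concat (replicate r (Xs k)))"
      by (auto simp: subseq_append_iff)
    have "sorted_wrt (\<lambda>p q. snd p > snd q) (Xs k)"
      by (simp only: Xs_def sorted_wrt_rev sorted_wrt_map) (simp del: upt_Suc)
    from subseq_sorted_wrt[OF I(2) this] have "sorted_wrt (\<lambda>p q. snd p > snd q) I1" .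
    then have "length I1 \<le> 1"
      using Suc.prems(2) I(1) by (cases I1; cases "tl I1") (auto simp: sorted_wrt_append)
    moreover have "length I2 \<le> r" using Suc I by (intro Suc.IH) (auto simp: sorted_wrt_append)
    ultimately show ?case using I by simp
  qed simp
  moreover have "sorted_wrt (\<lambda>p q. snd p < snd q) (run c s)"
    by (simp add: run_def sorted_wrt_map)
  ultimately have "length (run c s) \<le> s - 1" by blast
  then show False using assms by (simp add: run_def)
qed

lemma z_power_crit:
  "subseq (replicate r (False, Suc k)) (crit s k) \<longleftrightarrow> r \<le> s"
  "subseq (replicate r (True, Suc k)) (crit s k) \<longleftrightarrow> r \<le> s"
proof -
  have 1: "subseq (replicate r (False, Suc k)) (left_word s k @ v @ lstar (left_word s k)) \<longleftrightarrow> r \<le> s"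
    if "(False, Suc k) \<notin> set v" for v
  proof -
    have "filter (\<lambda>q. q = (False, Suc k)) v = []"
      "filter (\<lambda>q. q = (False, Suc k)) (lstar (left_word s k)) = []"
      using that z_notin(4)[of k s] by (auto simp only: filter_empty_conv)
    then show ?thesis by (simp add: subseq_replicate_iff)
  qed
  show "subseq (replicate r (False, Suc k)) (crit s k) \<longleftrightarrow> r \<le> s"
    unfolding crit_def by (rule 1[OF z_notin(1)])
  have "subseq (replicate r (True, Suc k)) (crit s k) \<longleftrightarrow> subseq (replicate r (False, Suc k)) (lstar (crit s k))"
    by (simp add: subseq_lstar)
  then show "subseq (replicate r (True, Suc k)) (crit s k) \<longleftrightarrow> r \<le> s"
    unfolding lstar_crit using 1[OF z_notin(2)] by simp
qed

text \<open>The only test of degree \<open>2 * (n div 2)\<close> needed: starring a literal moves it to the other half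
  of the alphabet, so \<open>x\<^sub>a\<close> and \<open>x\<^sub>b\<close> cannot be told apart in it.\<close>

lemma holds_framed_pair:
  assumes h: "holds n u v" and s: "n div 2 = Suc s"
    and u: "subseq (framed s k [(True, c), (False, d)]) u" "c \<in> {a, b}" "d \<in> {a, b}"
  shows "\<exists>c\<in>{a, b}. \<exists>d\<in>{a, b}. subseq (framed s k [(True, c), (False, d)]) v"
proof -
  \<comment> \<open>The outer positions are pinned to \<open>z\<close> and \<open>z*\<close>; the
    two central ones have to share one set, which contains both starred candidates.\<close>
  let ?P = "\<lambda>t. if t < s then {(False, Suc k)} else {(True, a), (True, b) :: lit}"
  have nth1: "framed s k [p, q] ! t = (if t < s then (False, Suc k) else p)" if "t < Suc s" for t p q
    using that by (auto simp: framed_def nth_append)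
  have nth2: "framed s k [p, q] ! (2 * Suc s - 1 - t) = (if t < s then (True, Suc k) else q)"
    if "t < Suc s" for t p q
    using that by (auto simp: framed_def nth_append nth_Cons split: nat.splits)
  have len: "length (framed s k [p, q]) = 2 * Suc s" for p q by (simp add: framed_def)
  have "framed s k [(True, c), (False, d)] ! t \<in> ?P t \<and>
      bar (framed s k [(True, c), (False, d)] ! (2 * Suc s - 1 - t)) \<in> ?P t" if "t < Suc s" for t
    unfolding nth1[OF that] nth2[OF that] using u(2,3) by auto
  from holds_full_test[OF h u(1) s[symmetric] len this]
  obtain m' where m': "subseq m' v" "length m' = 2 * Suc s"
    "\<And>t. t < Suc s \<Longrightarrow> m' ! t \<in> ?P t \<and> bar (m' ! (2 * Suc s - 1 - t)) \<in> ?P t"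
    by blast
  obtain c' d' where cd: "m' ! s = (True, c')" "m' ! Suc s = (False, d')" "c' \<in> {a, b}" "d' \<in> {a, b}"
  proof -
    have "bar (m' ! Suc s) \<in> {(True, a), (True, b)}" using m'(3)[of s] by simp
    then have "m' ! Suc s \<in> {(False, a), (False, b)}" by (auto simp: bar_def prod_eq_iff)
    then show ?thesis using m'(3)[of s] that by auto
  qed
  have "m' = framed s k [(True, c'), (False, d')]"
  proof (rule nth_equalityI)
    fix t assume "t < length m'"
    then have t: "t < 2 * Suc s" using m' by simp
    show "m' ! t = framed s k [(True, c'), (False, d')] ! t"
    proof (cases "t < Suc s")
      case True
      then show ?thesis using m'(3)[of t] cd by (subst nth1) (auto simp: less_Suc_eq split: if_splits)
    next
      case False
      define t' where "t' = 2 * Suc s - 1 - t"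
      have t': "t' < Suc s" "t = 2 * Suc s - 1 - t'" using False t by (auto simp: t'_def)
      show ?thesis
      proof (cases "t' = s")
        case True
        then have "t = Suc s" using t' by simp
        then show ?thesis using cd by (simp add: framed_def nth_append)
      next
        case False
        then have "bar (m' ! t) = (False, Suc k)" using m'(3)[of t'] t' by auto
        then have "m' ! t = (True, Suc k)" by (metis bar_bar bar_simps(2))
        then show ?thesis unfolding t'(2) using nth2[OF t'(1)] t' False by simp
      qed
    qed
  qed (simp add: m' len)
  then show ?thesis using m' cd by metis
qed


section \<open>Subword combinatorics\<close>

lemma subseq_appendD:
  assumes "subseq (u @ v) w"
  shows "subseq u w" "subseq v w"
  using assms by (auto intro: subseq_order.trans[OF _ assms] subseq_drop_many subseq_rev_drop_many)

lemma subseq_skip: "p \<notin> set X \<Longrightarrow> subseq (p # u) (X @ Y) \<longleftrightarrow> subseq (p # u) Y"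
  by (induction X) (auto simp: subseq_Cons2_neq)

text \<open>Embed \<open>p\<close> greedily: \<open>P\<close> ends with its leftmost embedding, and
  \<open>M\<close> is what remains.\<close>

lemma subseq_residual:
  "subseq p w \<Longrightarrow> \<exists>P M. w = P @ M \<and> subseq p P \<and> (\<forall>m. subseq (p @ m) w \<longleftrightarrow> subseq m M)"
proof (induction p arbitrary: w)
  case Nil
  then show ?case by (intro exI[of _ "[]"] exI[of _ w]) auto
next
  case (Cons a p)
  then have "a \<in> set w" by (auto dest: subseq_set)
  then obtain X Y where w: "w = X @ a # Y" "a \<notin> set X" by (metis split_list_first)
  then have "subseq p Y" using Cons.prems by (simp add: subseq_skip)
  from Cons.IH[OF this] obtain P M where
    "Y = P @ M" "subseq p P" "\<forall>m. subseq (p @ m) Y \<longleftrightarrow> subseq m M" by blast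
  moreover have "subseq (a # p) (X @ a # P)" if "subseq p P" for P
    by (rule subseq_drop_many) (simp add: that)
  moreover have "subseq ((a # p) @ m) w \<longleftrightarrow> subseq (p @ m) Y" for m
    using w by (simp add: subseq_skip)
  ultimately show ?case using w(1)
    by (intro exI[of _ "X @ a # P"] exI[of _ M]) simp
qed

lemma subseq_residual_right:
  assumes "subseq p w"
  shows "\<exists>M R. w = M @ R \<and> subseq p R \<and> (\<forall>m. subseq (m @ p) w \<longleftrightarrow> subseq m M)"
proof -
  have "subseq (rev p) (rev w)" using assms by (simp add: subseq_rev)
  from subseq_residual[OF this] obtain P M where
    *: "rev w = P @ M" "subseq (rev p) P" "\<forall>m. subseq (rev p @ m) (rev w) \<longleftrightarrow> subseq m M" by blast
  have "subseq (m @ p) w \<longleftrightarrow> subseq m (rev M)" for m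
    using *(3)[rule_format, of "rev m"] subseq_rev[of "m @ p" w] subseq_rev[of m "rev M"] by simp
  moreover have "w = rev M @ rev P" using *(1) by (metis rev_append rev_rev_ident)
  moreover have "subseq p (rev P)" using *(2) subseq_rev[of p "rev P"] by simp
  ultimately show ?thesis by (intro exI[of _ "rev M"] exI[of _ "rev P"]) simp
qed

text \<open>Whichever of \<open>p\<close>, \<open>p'\<close> occurs first in \<open>M\<close> is
  followed by everything that follows the other. This is the defining property of interval
  orders.\<close>

lemma subseq_pairs_exchange:
  assumes "subseq [p, q] M" "subseq [p', q'] M"
  shows "subseq [p, q'] M \<or> subseq [p', q] M"
proof -
  have "\<exists>r\<in>set M. r = p \<or> r = p'" using subseq_set[OF assms(1)] by auto
  from split_list_first_prop[OF this] obtain X r Y where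
    M: "M = X @ r # Y" and r: "r = p \<or> r = p'" and X: "\<forall>x\<in>set X. \<not> (x = p \<or> x = p')" by blast
  have tail: "b \<in> set Y" if "subseq [a, b] M" "a = p \<or> a = p'" for a b
  proof -
    have "subseq [a, b] (r # Y)" using that X unfolding M by (auto simp: subseq_skip)
    then have "subseq [b] Y" using subseq_Cons'[of a "[b]" Y] by (simp split: if_splits)
    then show ?thesis by (simp add: subseq_singleton_left)
  qed
  have "subseq [r, b] M" if "b \<in> set Y" for b
    unfolding M using that by (intro subseq_drop_many) (simp add: subseq_singleton_left)
  then show ?thesis using r tail assms by blast
qed

text \<open>A block boundary spoils at most one of the consecutive pieces, so with fewer blocks than
  pieces some piece lies within one block. The last conjunct records that \<open>R\<close> is still
  available behind it.\<close>

lemma block_pigeonhole: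
  assumes "concat Bs = P @ M @ R" "subseq (concat Cs) M" "length Bs < length Cs" "[] \<notin> set Cs"
  shows "\<exists>C\<in>set Cs. \<exists>Bs1 B1 B B2 Bs2 q. Bs = Bs1 @ (B1 @ B @ B2) # Bs2 \<and> subseq C B \<and>
    set B \<subseteq> set M \<and> B2 @ concat Bs2 = q @ R"
  using assms
proof (induction Bs arbitrary: P M Cs)
  case Nil
  then show ?case by (cases Cs) auto
next
  case (Cons B Bs)
  obtain C Cs' where Cs: "Cs = C # Cs'" using Cons.prems(3) by (cases Cs) auto
  have "B @ concat Bs = P @ M @ R" using Cons.prems(1) by simp
  then consider us where "P = B @ us" "us @ M @ R = concat Bs"
    | us vs where "B = P @ us" "us = M @ vs" "vs @ concat Bs = R"
    | us vs where "B = P @ us" "M = us @ vs" "concat Bs = vs @ R"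
    unfolding append_eq_append_conv2 by metis
  then show ?case
  proof cases
    case 1
    have "\<exists>C\<in>set Cs. \<exists>Bs1 B1 B B2 Bs2 q. Bs = Bs1 @ (B1 @ B @ B2) # Bs2 \<and> subseq C B \<and>
      set B \<subseteq> set M \<and> B2 @ concat Bs2 = q @ R"
      using Cons.prems 1 by (intro Cons.IH[of us M Cs]) auto
    then show ?thesis by (metis append_Cons)
  next
    case 2
    have "subseq C M" using Cons.prems(2) unfolding Cs by (auto dest: subseq_appendD)
    then show ?thesis using 2 Cs
      by (intro bexI[of _ C] exI[of _ "[]"] exI[of _ P] exI[of _ M] exI[of _ vs] exI[of _ Bs]) auto
  next
    case 3
    have "subseq (C @ concat Cs') (us @ vs)" using Cons.prems(2) unfolding Cs 3 by simp
    then obtain x1 x2 where x: "C @ concat Cs' = x1 @ x2" "subseq x1 us" "subseq x2 vs"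
      unfolding subseq_append_iff by blast
    from x(1) consider t where "x1 = C @ t" | t where "t @ concat Cs' = x2"
      unfolding append_eq_append_conv2 by metis
    then show ?thesis
    proof cases
      case (1 t)
      then have "subseq C us" using x(2) by (auto dest: subseq_appendD)
      moreover have "C \<in> set Cs" "B # Bs = [] @ (P @ us @ []) # Bs" "set us \<subseteq> set M"
        "[] @ concat Bs = vs @ R" using 3 Cs by simp_all
      ultimately show ?thesis by blast
    next
      case (2 t)
      then have "subseq (concat Cs') vs" using x(3) by (auto dest: subseq_appendD)
      then have "\<exists>C\<in>set Cs'. \<exists>Bs1 B1 B B2 Bs2 q. Bs = Bs1 @ (B1 @ B @ B2) # Bs2 \<and> subseq C B \<and>
        set B \<subseteq> set vs \<and> B2 @ concat Bs2 = q @ R"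
        using Cons.prems Cs 3 by (intro Cons.IH[of "[]" vs Cs']) auto
      then obtain C' Bs1 B1 B' B2 Bs2 q where "C' \<in> set Cs'" "Bs = Bs1 @ (B1 @ B' @ B2) # Bs2"
        "subseq C' B'" "set B' \<subseteq> set vs" "B2 @ concat Bs2 = q @ R" by blast
      then show ?thesis using 3 Cs
        by (intro bexI[of _ C'] exI[of _ "B # Bs1"] exI[of _ B1] exI[of _ B'] exI[of _ B2]
          exI[of _ Bs2] exI[of _ q]) auto
    qed
  qed
qed

lemma concat_map_split:
  assumes "concat (map g v) = X @ a # Z"
  shows "\<exists>v1 q v2 F1 F2. v = v1 @ q # v2 \<and> g q = F1 @ a # F2 \<and> X = concat (map g v1) @ F1 \<and>
    Z = F2 @ concat (map g v2)"
  using assms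
proof (induction v arbitrary: X)
  case (Cons q v)
  then have "g q @ concat (map g v) = X @ a # Z" by simp
  then consider us where "X = g q @ us" "us @ a # Z = concat (map g v)"
    | us where "g q = X @ us" "us \<noteq> []" "us @ concat (map g v) = a # Z"
    unfolding append_eq_append_conv2 by (metis append.right_neutral append_Nil)
  then show ?case
  proof cases
    case 1
    from Cons.IH[of us] 1 obtain v1 q' v2 F1 F2 where "v = v1 @ q' # v2" "g q' = F1 @ a # F2"
      "us = concat (map g v1) @ F1" "Z = F2 @ concat (map g v2)" by metis
    then show ?thesis using 1
      by (intro exI[of _ "q # v1"] exI[of _ q'] exI[of _ v2] exI[of _ F1] exI[of _ F2]) auto
  next
    case 2
    then obtain us' where "us = a # us'" by (cases us) auto
    then show ?thesis using 2
      by (intro exI[of _ "[]"] exI[of _ q] exI[of _ v] exI[of _ X] exI[of _ us']) auto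
  qed
qed simp

text \<open>In the arrangement of \<open>W\<close>, interval \<open>j\<close> ends before interval
  \<open>j + 2\<close> begins; these are such ends and beginnings in their order of
  occurrence.\<close>

definition pairs :: "nat \<Rightarrow> nat \<Rightarrow> lit list" where
  "pairs c r = concat (map (\<lambda>j. [(True, j), (False, j + 2)]) [c..<c + r])"

lemma pairs_0 [simp]: "pairs c 0 = []"
  by (simp add: pairs_def)

lemma pairs_Suc: "pairs c (Suc r) = (True, c) # (False, c + 2) # pairs (Suc c) r"
  by (simp add: pairs_def upt_conv_Cons del: upt_Suc)

lemma pairs_add: "pairs c (q + r) = pairs c q @ pairs (c + q) r"
  by (induction q arbitrary: c) (simp_all add: pairs_Suc)

lemma concat_pairs: "concat (map (\<lambda>i. pairs (i * r) r) [0..<K]) = pairs 0 (K * r)"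
  by (induction K) (simp_all add: add.commute[of r] pairs_add[of 0 _ r, simplified])

lemma run_Suc: "run c (Suc r) = (False, c) # run (Suc c) r"
  by (simp add: run_def upt_conv_Cons del: upt_Suc)

lemma run_snoc: "run c (Suc r) = run c r @ [(False, c + r)]"
  by (simp add: run_def)

lemma run_pairs: "subseq (run (c + 2) r) (pairs c r)"
proof (induction r arbitrary: c)
  case (Suc r)
  have "subseq (run (Suc c + 2) r) (pairs (Suc c) r)" by (rule Suc.IH)
  then show ?case by (simp add: run_Suc pairs_Suc)
qed (simp add: run_def)

text \<open>If the first \<open>x\<^sub>a\<^sup>*\<close> precedes the last \<open>x\<^sub>b\<close> exactly for \<open>a + 2 \<le> b\<close>, then the last \<open>x\<^sub>b\<close>
  and the first \<open>x\<^sub>a\<^sup>*\<close> alternate.\<close>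

lemma pairs_subseq:
  assumes "c + r + 1 \<le> k"
    and "\<And>a b. \<lbrakk>c \<le> a; a + 2 \<le> b; b \<le> k\<rbrakk> \<Longrightarrow> subseq [(True, a), (False, b)] M"
    and "\<And>a b. \<lbrakk>a \<le> k; b \<le> k; b < a + 2\<rbrakk> \<Longrightarrow> \<not> subseq [(True, a), (False, b)] M"
  shows "subseq (pairs c r) M"
  using assms
proof (induction r arbitrary: c M)
  case (Suc r)
  have cc: "subseq [(True, c), (False, c + 2)] M" using Suc.prems(1) by (intro Suc.prems(2)) auto
  then have "(False, c + 2) \<in> set M" by (auto dest: subseq_set)
  \<comment> \<open>Cut at the last \<open>x_b\<close> with \<open>b = c + 2\<close>. No
    \<open>x_a*\<close> with \<open>c < a \<le> k\<close> precedes it, so the pairs starting from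
    \<open>c + 1\<close> survive in \<open>B\<close>.\<close>
  then obtain A B where M: "M = A @ (False, c + 2) # B" "(False, c + 2) \<notin> set B"
    by (metis split_list_last)
  have A: "(True, a) \<notin> set A" if "c + 1 \<le> a" "a \<le> k" for a
  proof
    assume "(True, a) \<in> set A"
    then have "subseq ([(True, a)] @ [(False, c + 2)]) M"
      unfolding M by (intro list_emb_append_mono) (auto simp: subseq_singleton_left)
    then show False using Suc.prems(3)[of a "c + 2"] Suc.prems(1) that by simp
  qed
  have "(True, c) \<in> set A"
  proof (rule ccontr)
    assume "(True, c) \<notin> set A"
    then have "subseq [(True, c), (False, c + 2)] ((False, c + 2) # B)"
      using cc unfolding M by (simp add: subseq_skip)
    then have "(False, c + 2) \<in> set B" by (auto dest: subseq_set)
    then show False using M(2) by simp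
  qed
  moreover have "subseq (pairs (Suc c) r) B"
  proof (rule Suc.IH)
    show "Suc c + r + 1 \<le> k" using Suc.prems(1) by simp
    show "subseq [(True, a), (False, b)] B" if "Suc c \<le> a" "a + 2 \<le> b" "b \<le> k" for a b
      using Suc.prems(2)[of a b] that A[of a] unfolding M by (simp add: subseq_skip)
    show "\<not> subseq [(True, a), (False, b)] B" if "a \<le> k" "b \<le> k" "b < a + 2" for a b
      using Suc.prems(3)[OF that] unfolding M by (auto intro: subseq_drop_many)
  qed
  ultimately have "subseq ([(True, c)] @ (False, c + 2) # pairs (Suc c) r) M"
    unfolding M by (intro list_emb_append_mono) (auto simp: subseq_singleton_left)
  then show ?case by (simp add: pairs_Suc)
qed simp


section \<open>The invariant and its preservation\<close>

context
  fixes n s k :: nat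
  assumes half: "n div 2 = Suc s" and k: "2 \<le> k"
begin

definition arrow :: "nat \<Rightarrow> nat \<Rightarrow> lit list \<Rightarrow> bool" where
  "arrow a b w \<longleftrightarrow> subseq (framed s k [(True, a), (False, b)]) w"

text \<open>One arrow between the extreme indices determines all others
  (\<open>arrow_good_iff\<close>), so this captures the words equivalent to \<open>W\<close> that
  have its direction.\<close>

definition good :: "lit list \<Rightarrow> bool" where
  "good w \<longleftrightarrow> holds n (crit s k) w \<and> arrow 0 k w"

lemma arrow_crit: "\<lbrakk>a \<le> k; b \<le> k\<rbrakk> \<Longrightarrow> arrow a b (crit s k) \<longleftrightarrow> a + 2 \<le> b"
  by (simp add: arrow_def framed_crit subseq_pair_mid)

lemma arrow_lstar_crit: "\<lbrakk>a \<le> k; b \<le> k\<rbrakk> \<Longrightarrow> arrow a b (lstar (crit s k)) \<longleftrightarrow> b + 2 \<le> a"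
  by (simp add: arrow_def framed_crit lstar_framed subseq_lstar subseq_pair_mid)

lemma good_crit: "good (crit s k)"
  using k by (simp add: good_def holds_refl arrow_crit)

lemma not_good_lstar_crit: "\<not> good (lstar (crit s k))"
  by (simp add: good_def arrow_lstar_crit)

text \<open>The full test sees only the set \<open>{a, b}\<close>, and \<open>crit s k\<close> has
  no arrow among indices differing by at most 1.\<close>

lemma arrow_near:
  assumes "holds n (crit s k) w" "a \<le> k" "b \<le> k" "a \<le> b + 1" "b \<le> a + 1"
  shows "\<not> arrow a b w"
proof
  assume "arrow a b w"
  then obtain c d where "c \<in> {a, b}" "d \<in> {a, b}" "arrow c d (crit s k)"
    using holds_framed_pair[OF holds_sym[OF assms(1)] half, of k a b a b] unfolding arrow_def by blast
  then show False using assms arrow_crit[of c d] by auto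
qed

lemma arrow_far:
  assumes "holds n (crit s k) w" "a + 2 \<le> b" "b \<le> k"
  shows "arrow a b w \<or> arrow b a w"
proof -
  have "arrow a b (crit s k)" using assms by (subst arrow_crit) auto
  then obtain c d where cd: "c \<in> {a, b}" "d \<in> {a, b}" "arrow c d w"
    using holds_framed_pair[OF assms(1) half, of k a b a b] unfolding arrow_def by blast
  then have "c \<noteq> d" using arrow_near[OF assms(1), of c d] assms by auto
  then show ?thesis using cd by auto
qed

text \<open>The frame is embedded greedily from the left and then from the right, so the same factor
  \<open>M\<close> serves for every \<open>m\<close>.\<close>

lemma middle:
  assumes "subseq (framed s k []) w"
  shows "\<exists>P M R. w = P @ M @ R \<and> subseq (replicate s (True, Suc k)) R \<and>
    (\<forall>m. subseq (framed s k m) w \<longleftrightarrow> subseq m M)"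
proof -
  let ?z = "replicate s (False, Suc k)" and ?z' = "replicate s (True, Suc k)"
  have "subseq ?z w" using assms unfolding framed_def by (auto dest: subseq_appendD)
  from subseq_residual[OF this] obtain P N where
    PN: "w = P @ N" "\<And>m. subseq (?z @ m) w \<longleftrightarrow> subseq m N" by blast
  have "subseq ?z' N" using assms unfolding framed_def PN(2) by simp
  from subseq_residual_right[OF this] obtain M R where
    "N = M @ R" "subseq ?z' R" "\<And>m. subseq (m @ ?z') N \<longleftrightarrow> subseq m M" by blast
  then show ?thesis using PN by (auto simp: framed_def)
qed

lemma arrow_exchange:
  assumes "arrow a b w" "arrow c d w"
  shows "arrow a d w \<or> arrow c b w"
proof -
  have "subseq (framed s k []) w"
    using assms(1) unfolding arrow_def framed_def
    by (rule subseq_order.trans[rotated]) (auto intro: list_emb_append_mono)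
  from middle[OF this] obtain M where "\<And>m. subseq (framed s k m) w \<longleftrightarrow> subseq m M" by blast
  then show ?thesis using assms subseq_pairs_exchange unfolding arrow_def by metis
qed

text \<open>If the arrow at \<open>b'\<close> were reversed, exchanging it with the one from
  \<open>a\<close> to \<open>b\<close> would give an arrow from \<open>a\<close> to itself or from
  \<open>b'\<close> to its neighbour \<open>b\<close>.\<close>

lemma arrow_move_right:
  assumes h: "holds n (crit s k) w" and "arrow a b w" "b \<le> b' + 1" "b' \<le> b + 1" "a \<le> k" "b \<le> k" "b' \<le> k"
    "a + 2 \<le> b' \<or> b' + 2 \<le> a"
  shows "arrow a b' w"
proof (rule ccontr)
  assume "\<not> arrow a b' w"
  then have "arrow b' a w" using arrow_far[OF h] assms by blast
  from arrow_exchange[OF assms(2) this] show False using arrow_near[OF h] assms by auto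
qed

lemma arrow_move_left:
  assumes h: "holds n (crit s k) w" and "arrow a b w" "a \<le> a' + 1" "a' \<le> a + 1" "a \<le> k" "b \<le> k" "a' \<le> k"
    "a' + 2 \<le> b \<or> b + 2 \<le> a'"
  shows "arrow a' b w"
proof (rule ccontr)
  assume "\<not> arrow a' b w"
  then have "arrow b a' w" using arrow_far[OF h] assms by blast
  from arrow_exchange[OF assms(2) this] show False using arrow_near[OF h] assms by auto
qed

text \<open>Unit steps that move the two indices apart carry the arrow from
  \<open>(c, c + 2)\<close> to \<open>(0, k)\<close>.\<close>

lemma arrow_extend:
  assumes h: "holds n (crit s k) w" and "arrow c (c + 2) w" "c + 2 \<le> k"
  shows "arrow 0 k w"
proof -
  have 1: "c + 2 + j \<le> k \<Longrightarrow> arrow c (c + 2 + j) w" for j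
  proof (induction j)
    case (Suc j)
    then show ?case using arrow_move_right[OF h, of c "c + 2 + j" "c + 2 + Suc j"] by simp
  qed (use assms in simp)
  have "j \<le> c \<Longrightarrow> arrow (c - j) k w" for j
  proof (induction j)
    case 0
    have "c + 2 + (k - (c + 2)) = k" using assms(3) by simp
    then show ?case using 1[of "k - (c + 2)"] by (metis diff_zero order_refl)
  next
    case (Suc j)
    then show ?case using assms(3) by (intro arrow_move_left[OF h, of "c - j" k "c - Suc j"]) auto
  qed
  from this[of c] show ?thesis by simp
qed

lemma arrow_good:
  assumes "good w" "a + 2 \<le> b" "b \<le> k"
  shows "arrow a b w"
proof -
  have h: "holds n (crit s k) w" and 0: "arrow 0 k w" using assms unfolding good_def by auto
  have 1: "2 \<le> k - j \<Longrightarrow> arrow 0 (k - j) w" for j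
  proof (induction j)
    case (Suc j)
    then show ?case by (intro arrow_move_right[OF h, of 0 "k - j" "k - Suc j"]) auto
  qed (use 0 in simp)
  have "a + 2 \<le> b \<Longrightarrow> arrow a b w" for a
  proof (induction a)
    case 0
    then show ?case using 1[of "k - b"] assms by simp
  next
    case (Suc a)
    then show ?case using assms(3) by (intro arrow_move_left[OF h, of a b "Suc a"]) auto
  qed
  then show ?thesis using assms(2) .
qed

lemma arrow_good_iff:
  assumes "good w" "a \<le> k" "b \<le> k"
  shows "arrow a b w \<longleftrightarrow> a + 2 \<le> b"
proof
  have h: "holds n (crit s k) w" using assms unfolding good_def by auto
  assume ab: "arrow a b w"
  show "a + 2 \<le> b"
  proof (rule ccontr)
    assume "\<not> a + 2 \<le> b"
    then consider "a \<le> b + 1" "b \<le> a + 1" | "b + 2 \<le> a" by linarith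
    then show False
    proof cases
      case 1
      then show False using ab arrow_near[OF h] assms by auto
    next
      case 2
      from arrow_exchange[OF ab arrow_good[OF assms(1) this assms(2)]]
      show False using arrow_near[OF h] assms by auto
    qed
  qed
qed (rule arrow_good[OF assms(1) _ assms(3)])

lemma z_power:
  assumes "holds n (crit s k) w" "r \<le> Suc s"
  shows "subseq (replicate r (b, Suc k)) w \<longleftrightarrow> r \<le> s"
proof -
  have n: "2 * length (replicate r (b, Suc k)) \<le> n" using half assms(2) by simp
  have "subseq (replicate r (b, Suc k)) w \<longleftrightarrow> subseq (replicate r (b, Suc k)) (crit s k)"
    using holds_short_subseq[OF assms(1) _ n] holds_short_subseq[OF holds_sym[OF assms(1)] _ n] by blast
  then show ?thesis by (cases b) (simp_all add: z_power_crit)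
qed

section \<open>Short identities preserve the direction\<close>

lemma preserve_good:
  assumes uv: "holds n u v" and gu: "good (subst lstar f u)"
    and K: "length u < K" "K * Suc s + 1 = k"
  shows "good (subst lstar f v)"
proof -
  let ?w = "subst lstar f u" and ?w' = "subst lstar f v"
  let ?z = "(False, Suc k) :: lit" and ?z' = "(True, Suc k) :: lit"
  have h: "holds n (crit s k) ?w" using gu unfolding good_def by simp
  have h': "holds n (crit s k) ?w'" by (rule holds_trans[OF h holds_subst[OF uv]])
  have "arrow 0 k ?w" using gu unfolding good_def by simp
  then have "subseq (framed s k []) ?w"
    unfolding arrow_def framed_def
    by (rule subseq_order.trans[rotated]) (auto intro: list_emb_append_mono)
  from middle[OF this] obtain P M R where
    PMR: "?w = P @ M @ R" "subseq (replicate s ?z') R" "\<And>m. subseq (framed s k m) ?w \<longleftrightarrow> subseq m M"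
    by blast
  have zM: "(b, Suc k) \<notin> set M" for b
  proof
    assume "(b, Suc k) \<in> set M"
    then have "subseq (framed s k [(b, Suc k)]) ?w" unfolding PMR(3) by (simp add: subseq_singleton_left)
    moreover have "subseq (replicate (Suc s) (b, Suc k)) (framed s k [(b, Suc k)])"
      unfolding subseq_replicate_iff framed_def by (cases b) simp_all
    ultimately have "subseq (replicate (Suc s) (b, Suc k)) ?w" by (rule subseq_order.trans[rotated])
    then show False using z_power[OF h, of "Suc s" b] by simp
  qed
  have "subseq (pairs 0 (K * Suc s)) M"
  proof (rule pairs_subseq[of _ _ k])
    show "subseq [(True, a), (False, b)] M" if "a + 2 \<le> b" "b \<le> k" for a b
      using arrow_good[OF gu that] unfolding arrow_def PMR(3) .
    show "\<not> subseq [(True, a), (False, b)] M" if "a \<le> k" "b \<le> k" "b < a + 2" for a b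
      using arrow_good_iff[OF gu that(1,2)] that(3) unfolding arrow_def PMR(3) by simp
  qed (use K in simp)
  \<comment> \<open>There are \<open>K\<close> consecutive pieces of \<open>Suc s\<close> pairs, but
    fewer than \<open>K\<close> images of literals.\<close>
  then have sub: "subseq (concat (map (\<lambda>i. pairs (i * Suc s) (Suc s)) [0..<K])) M"
    by (simp only: concat_pairs)
  have "concat (map (simg lstar f) u) = P @ M @ R" using PMR(1) unfolding subst_def .
  moreover have "[] \<notin> set (map (\<lambda>i. pairs (i * Suc s) (Suc s)) [0..<K])"
    by (auto simp: pairs_Suc)
  ultimately have "\<exists>C\<in>set (map (\<lambda>i. pairs (i * Suc s) (Suc s)) [0..<K]). \<exists>Bs1 B1 B B2 Bs2 q.
      map (simg lstar f) u = Bs1 @ (B1 @ B @ B2) # Bs2 \<and> subseq C B \<and> set B \<subseteq> set M \<and>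
      B2 @ concat Bs2 = q @ R"
    using K(1) by (intro block_pigeonhole[OF _ sub]) simp_all
  then obtain C Bs1 B1 B B2 Bs2 q where
    C: "C \<in> (\<lambda>i. pairs (i * Suc s) (Suc s)) ` {0..<K}" and
    BC: "map (simg lstar f) u = Bs1 @ (B1 @ B @ B2) # Bs2" "subseq C B" "set B \<subseteq> set M" "B2 @ concat Bs2 = q @ R"
    by (simp only: set_map set_upt) (elim bexE exE conjE, blast)
  from C obtain i where i: "i < K" "C = pairs (i * Suc s) (Suc s)" by auto
  have Bs: "map (simg lstar f) u = Bs1 @ (B1 @ B @ B2) # Bs2" "subseq (pairs (i * Suc s) (Suc s)) B"
      "set B \<subseteq> set M" "B2 @ concat Bs2 = q @ R"
    using BC unfolding i(2) .
  obtain u1 p u2 where u: "u = u1 @ p # u2" "simg lstar f p = B1 @ B @ B2" "Bs2 = map (simg lstar f) u2"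
    using Bs(1) by (auto simp: map_eq_append_conv map_eq_Cons_conv)
  define c where "c = i * Suc s"
  have "Suc i * Suc s \<le> K * Suc s" using i(1) by (intro mult_le_mono1) simp
  then have ck: "c + s + 2 \<le> k" using K(2) by (simp add: c_def)
  have "subseq ((True, c) # (False, c + 2) # pairs (Suc c) s) B" using Bs(2) unfolding c_def pairs_Suc .
  then obtain D1 D2 where B: "B = D1 @ (True, c) # D2" "subseq ((False, c + 2) # pairs (Suc c) s) D2"
    by (auto dest!: list_emb_ConsD)
  have "subseq (run (c + 2) (Suc s)) ((False, c + 2) # pairs (Suc c) s)"
    using run_pairs[of "Suc c" s] by (simp add: run_Suc)
  then have D2: "subseq (run (c + 2) (Suc s)) D2" using B(2) by (rule subseq_order.trans)
  have zD: "(b, Suc k) \<notin> set D2" for b using zM[of b] Bs(3) unfolding B by auto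
  let ?V = "snd ` (\<Union>q\<in>set (u @ v) \<union> {p, bar p}. set (simg lstar f q)) \<union> {Suc k}"
  have "finite ?V" by simp
  then obtain y where y: "y \<notin> ?V" using ex_new_if_finite[OF infinite_UNIV_nat] by blast
  let ?Y = "(False, y) :: lit"
  \<comment> \<open>The marker \<open>?Y\<close> stands directly behind \<open>x_c*\<close>. Being
    fresh, it later identifies an occurrence of \<open>p\<close> in \<open>v\<close> and the place
    within its image; \<open>?er\<close> erases it again.\<close>
  define E where "E = B1 @ D1 @ (True, c) # ?Y # D2 @ B2"
  define g where "g = f(snd p := if fst p then lstar E else E)"
  have gp: "simg lstar g p = E" by (simp add: g_def simg_def)
  then have gbp: "simg lstar g (bar p) = lstar E" by (simp add: simg_bar_lstar)
  have gq: "simg lstar g q = simg lstar f q" if "q \<noteq> p" "q \<noteq> bar p" for q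
  proof -
    have "snd q \<noteq> snd p" using that by (cases q; cases p) (auto simp: bar_def)
    then show ?thesis by (simp add: g_def simg_def)
  qed
  have fresh: "(b, y) \<notin> set (simg lstar f q)" if "q \<in> set (u @ v) \<union> {p, bar p}" for b q
  proof
    assume "(b, y) \<in> set (simg lstar f q)"
    then have "snd (b, y) \<in> ?V" using that by blast
    then show False using y by simp
  qed
  let ?er = "filter (\<lambda>q. snd q \<noteq> y)"
  have fp: "(b, y) \<notin> set (B1 @ D1 @ (True, c) # D2 @ B2)" for b
    using fresh[of p b] unfolding u(2) B(1) by auto
  have er_id: "?er x = x" if "\<And>b. (b, y) \<notin> set x" for x :: "lit list"
    using that by (intro filter_True) (metis prod.collapse)
  have "?er E = ?er (B1 @ D1 @ (True, c) # D2 @ B2)" by (simp add: E_def)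
  also have "\<dots> = simg lstar f p" unfolding er_id[OF fp] u(2) B(1) by simp
  finally have erE: "?er E = simg lstar f p" .
  have er_lstar: "?er (lstar x) = lstar (?er x)" for x :: "lit list"
    by (induction x) (auto simp: bar_def)
  have er1: "?er (simg lstar g q) = simg lstar f q" if "q \<in> set (u @ v)" for q
  proof (cases "q = p \<or> q = bar p")
    case True
    then show ?thesis using erE gp gbp by (auto simp: er_lstar simg_bar_lstar)
  next
    case False
    then have "simg lstar g q = simg lstar f q" using gq by blast
    then show ?thesis using fresh[of q] that by (simp add: er_id)
  qed
  have er: "?er (subst lstar g x) = subst lstar f x" if "set x \<subseteq> set (u @ v)" for x
    using that er1 by (induction x) auto
  \<comment> \<open>This pattern has \<open>s + 1\<close> literals, so it is short enough to pass
    from \<open>u\<close> to \<open>v\<close>.\<close>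
  have "subseq (?Y # replicate s ?z') (subst lstar g u)"
  proof -
    have "subseq (replicate s ?z') (q @ R)" using PMR(2) by (rule subseq_drop_many)
    then have "subseq (replicate s ?z') (B2 @ subst lstar f u2)" using Bs(4) unfolding u(3) subst_def by simp
    moreover have "subseq (subst lstar f u2) (subst lstar g u2)"
    proof -
      have "?er (subst lstar g u2) = subst lstar f u2" using u(1) by (intro er) auto
      then show ?thesis by (metis subseq_filter_left)
    qed
    then have "subseq (B2 @ subst lstar f u2) (B2 @ subst lstar g u2)" by (simp add: subseq_append')
    ultimately have "subseq (replicate s ?z') (B2 @ subst lstar g u2)" by (rule subseq_order.trans)
    then have "subseq (?Y # replicate s ?z') (?Y # D2 @ B2 @ subst lstar g u2)"
      by (simp add: subseq_drop_many)
    then have "subseq (?Y # replicate s ?z') ((subst lstar g u1 @ B1 @ D1 @ [(True, c)]) @ ?Y # D2 @ B2 @ subst lstar g u2)"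
      by (rule subseq_drop_many)
    then show ?thesis unfolding u(1) by (simp add: gp E_def)
  qed
  then have "subseq (?Y # replicate s ?z') (subst lstar g v)"
    using half by (intro holds_short_subseq[OF holds_subst[OF uv]]) auto
  then obtain X Z where XZ: "subst lstar g v = X @ ?Y # Z" "subseq (replicate s ?z') Z"
    by (auto dest!: list_emb_ConsD)
  then obtain v1 p' v2 F1 F2 where v: "v = v1 @ p' # v2" "simg lstar g p' = F1 @ ?Y # F2"
    "Z = F2 @ subst lstar g v2"
    unfolding subst_def by (metis concat_map_split)
  have "p' = p"
  proof (rule ccontr)
    assume ne: "p' \<noteq> p"
    have Y: "?Y \<in> set (simg lstar g p')" unfolding v(2) by simp
    show False
    proof (cases "p' = bar p")
      case True
      then have "?Y \<in> bar ` set E" using Y gbp by simp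
      then have "(True, y) \<in> set E" by (auto simp: bar_def)
      then show False using fp[of True] by (auto simp: E_def)
    next
      case False
      then show False using Y gq[OF ne] fresh[of p' False] v(1) by auto
    qed
  qed
  then have "F1 @ ?Y # F2 = (B1 @ D1 @ [(True, c)]) @ ?Y # (D2 @ B2)" using v(2) gp by (simp add: E_def)
  moreover have "?Y \<notin> set (B1 @ D1 @ [(True, c)])" "?Y \<notin> set (D2 @ B2)" using fp[of False] by auto
  ultimately have "F2 = D2 @ B2" by (metis append_Cons_eq_iff)
  then have "subseq (replicate s ?z') (D2 @ B2 @ subst lstar g v2)" using XZ(2) v(3) by simp
  then have "subseq (?er (replicate s ?z')) (?er (D2 @ B2 @ subst lstar g v2))" by (rule subseq_filter)
  moreover have "?er (replicate s ?z') = replicate s ?z'" using y by (intro er_id) auto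
  moreover have "?er (D2 @ B2 @ subst lstar g v2) = D2 @ B2 @ subst lstar f v2"
  proof -
    have "?er D2 = D2" "?er B2 = B2" using fp by (intro er_id; simp)+
    moreover have "?er (subst lstar g v2) = subst lstar f v2" using v(1) by (intro er) auto
    ultimately show ?thesis by simp
  qed
  ultimately have "subseq (replicate s ?z') (D2 @ B2 @ subst lstar f v2)" by simp
  \<comment> \<open>\<open>D2\<close> comes from the middle part and contains no \<open>z*\<close>,
    so the copies of \<open>z*\<close> all lie behind it.\<close>
  then have tail: "subseq (replicate s ?z') (B2 @ subst lstar f v2)"
    using zD[of True] by (cases s) (auto simp: subseq_skip)
  have w': "?w' = (subst lstar f v1 @ B1 @ D1) @ (True, c) # D2 @ B2 @ subst lstar f v2"
    unfolding v(1) \<open>p' = p\<close> by (simp add: u(2) B(1))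
  have "subseq (replicate s ?z) ?w'" using z_power[OF h', of s False] by simp
  \<comment> \<open>A \<open>z\<close> behind \<open>D2\<close> would follow the run inside
    \<open>D2\<close>. That pattern of \<open>s + 1\<close> literals would pass back to
    \<open>crit s k\<close>, against \<open>run_not_subseq\<close>. Hence all \<open>s\<close>
    letters \<open>z\<close> precede \<open>x_c*\<close>.\<close>
  moreover have "filter (\<lambda>q. q = ?z) (D2 @ B2 @ subst lstar f v2) = []" if "s > 0"
  proof -
    have "?z \<notin> set (B2 @ subst lstar f v2)"
    proof
      assume "?z \<in> set (B2 @ subst lstar f v2)"
      then have "subseq [?z] (B2 @ subst lstar f v2)" by (simp only: subseq_singleton_left)
      moreover have "subseq (run (c + 2) s) D2"
        using D2 by (rule subseq_order.trans[rotated]) (simp add: run_snoc subseq_rev_drop_many)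
      ultimately have "subseq (run (c + 2) s @ [?z]) (D2 @ B2 @ subst lstar f v2)"
        by (intro list_emb_append_mono)
      then have "subseq (run (c + 2) s @ [?z]) ?w'"
        unfolding w' by (rule subseq_drop_many[OF list_emb_Cons])
      then have "subseq (run (c + 2) s @ [?z]) (crit s k)"
        using half by (intro holds_short_subseq[OF holds_sym[OF h']]) (auto simp: run_def)
      moreover have "c + 2 + s \<le> Suc k" using ck by simp
      ultimately show False using run_not_subseq[OF that] by blast
    qed
    then show ?thesis using zD[of False] by (auto simp: filter_empty_conv)
  qed
  ultimately have head: "subseq (replicate s ?z) (subst lstar f v1 @ B1 @ D1)"
    unfolding w' by (cases "s = 0") (auto simp: subseq_replicate_iff)
  have "(False, c + 2) \<in> set D2" using subseq_set[OF D2] by (simp add: run_Suc)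
  then have "subseq [(False, c + 2)] D2" by (simp add: subseq_singleton_left)
  then have "subseq ([(False, c + 2)] @ replicate s ?z') (D2 @ (B2 @ subst lstar f v2))"
    using tail by (rule list_emb_append_mono)
  then have "subseq ((True, c) # (False, c + 2) # replicate s ?z') ((True, c) # D2 @ B2 @ subst lstar f v2)"
    by simp
  with head have "subseq (replicate s ?z @ (True, c) # (False, c + 2) # replicate s ?z') ?w'"
    unfolding w' by (rule list_emb_append_mono)
  then have "arrow c (c + 2) ?w'" by (simp add: arrow_def framed_def)
  then show ?thesis unfolding good_def using h' arrow_extend[OF h'] ck by simp
qed

text \<open>A context is absorbed by two fresh variables.\<close>

lemma preserve_good_context:
  assumes uv: "holds n u v" and gu: "good (a @ subst lstar f u @ b)"
    and K: "length u + 2 < K" "K * Suc s + 1 = k"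
  shows "good (a @ subst lstar f v @ b)"
proof -
  obtain N where N: "\<And>q. q \<in> set (u @ v) \<Longrightarrow> snd q < N"
    using finite_nat_set_iff_bounded[of "snd ` set (u @ v)"] by auto
  let ?ext = "\<lambda>u. [(False, N)] @ u @ [(False, Suc N)]"
  define g where "g = f(N := a, Suc N := b)"
  have "simg lstar g q = simg lstar f q" if "q \<in> set (u @ v)" for q
    using N[OF that] by (simp add: g_def simg_def)
  then have "subst lstar g x = subst lstar f x" if "set x \<subseteq> set (u @ v)" for x
    using that unfolding subst_def by (intro arg_cong[of _ _ concat] map_cong) auto
  then have g: "subst lstar g (?ext x) = a @ subst lstar f x @ b" if "set x \<subseteq> set (u @ v)" for x
    using that by (simp add: simg_def g_def[symmetric]) (simp add: g_def)
  have "holds n (?ext u) (?ext v)" by (intro holds_append holds_refl uv)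
  moreover have "good (subst lstar g (?ext u))" using gu by (subst g) auto
  ultimately have "good (subst lstar g (?ext v))"
    by (rule preserve_good[OF _ _ _ K(2)]) (use K(1) in simp)
  then show ?thesis by (subst (asm) g) auto
qed

end


section \<open>Syntactic involution monoids\<close>

text \<open>The second condition makes the syntactic congruence of \<open>G\<close> compatible with
  \<open>lstar\<close>.\<close>

definition syn :: "(lit list \<Rightarrow> bool) \<Rightarrow> lit list \<Rightarrow> lit list \<Rightarrow> bool" where
  "syn G u v \<longleftrightarrow>
     (\<forall>a b. (G (a @ u @ b) \<longleftrightarrow> G (a @ v @ b)) \<and> (G (a @ lstar u @ b) \<longleftrightarrow> G (a @ lstar v @ b)))"

definition syn_class :: "(lit list \<Rightarrow> bool) \<Rightarrow> lit list \<Rightarrow> lit list set" where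
  "syn_class G u = {v. syn G u v}"

definition syn_monoid :: "(lit list \<Rightarrow> bool) \<Rightarrow> lit list set monoid" where
  "syn_monoid G = \<lparr>carrier = range (syn_class G),
     mult = (\<lambda>X Y. syn_class G ((SOME x. x \<in> X) @ (SOME y. y \<in> Y))), one = syn_class G []\<rparr>"

definition syn_star :: "(lit list \<Rightarrow> bool) \<Rightarrow> lit list set \<Rightarrow> lit list set" where
  "syn_star G X = syn_class G (lstar (SOME x. x \<in> X))"

lemma syn_class_mem: "v \<in> syn_class G u \<longleftrightarrow> syn G u v"
  by (simp add: syn_class_def)

lemma syn_refl: "syn G u u"
  by (simp add: syn_def)

lemma syn_sym: "syn G u v \<Longrightarrow> syn G v u"
  by (simp add: syn_def)

lemma syn_trans: "syn G u v \<Longrightarrow> syn G v w \<Longrightarrow> syn G u w"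
  by (simp add: syn_def)

lemma syn_class_eq_iff: "syn_class G u = syn_class G v \<longleftrightarrow> syn G u v"
  by (metis (no_types, lifting) Set.set_eqI syn_class_mem syn_refl syn_sym syn_trans)

lemma syn_some: "syn G (SOME x. x \<in> syn_class G u) u"
  by (rule syn_sym[OF syn_class_mem[THEN iffD1, OF someI[of "\<lambda>x. x \<in> syn_class G u" u]]])
    (simp add: syn_class_mem syn_refl)

lemma syn_append:
  assumes "syn G u u'" "syn G v v'"
  shows "syn G (u @ v) (u' @ v')"
proof -
  have "G (a @ (u @ v) @ b) \<longleftrightarrow> G (a @ (u' @ v') @ b)" for a b
  proof -
    have "G (a @ u @ (v @ b)) \<longleftrightarrow> G (a @ u' @ (v @ b))" using assms(1) unfolding syn_def by blast
    moreover have "G ((a @ u') @ v @ b) \<longleftrightarrow> G ((a @ u') @ v' @ b)" using assms(2) unfolding syn_def by blast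
    ultimately show ?thesis by simp
  qed
  moreover have "G (a @ lstar (u @ v) @ b) \<longleftrightarrow> G (a @ lstar (u' @ v') @ b)" for a b
  proof -
    have "G (a @ lstar v @ (lstar u @ b)) \<longleftrightarrow> G (a @ lstar v' @ (lstar u @ b))"
      using assms(2) unfolding syn_def by blast
    moreover have "G ((a @ lstar v') @ lstar u @ b) \<longleftrightarrow> G ((a @ lstar v') @ lstar u' @ b)"
      using assms(1) unfolding syn_def by blast
    ultimately show ?thesis by simp
  qed
  ultimately show ?thesis unfolding syn_def by blast
qed

lemma syn_lstar: "syn G u v \<Longrightarrow> syn G (lstar u) (lstar v)"
  by (simp add: syn_def)

lemma syn_mult: "syn_class G u \<otimes>\<^bsub>syn_monoid G\<^esub> syn_class G v = syn_class G (u @ v)"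
  by (simp add: syn_monoid_def syn_class_eq_iff syn_append syn_some)

lemma syn_star_class: "syn_star G (syn_class G u) = syn_class G (lstar u)"
  by (simp add: syn_star_def syn_class_eq_iff syn_lstar syn_some)

lemma syn_carrier: "carrier (syn_monoid G) = range (syn_class G)"
  and syn_one: "\<one>\<^bsub>syn_monoid G\<^esub> = syn_class G []"
  by (simp_all add: syn_monoid_def)

lemma involution_monoid_syn: "involution_monoid (syn_monoid G) (syn_star G)"
  by unfold_locales (auto simp: syn_carrier syn_one syn_mult syn_star_class)

lemma eval_syn:
  "eval (syn_monoid G) (syn_star G) (\<lambda>i. syn_class G (f i)) t = syn_class G (subst lstar f (nf t))"
  by (induction t) (simp_all add: syn_one syn_mult syn_star_class subst_lstar_lstar simg_def)

lemma satisfies_syn: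
  "satisfies (syn_monoid G) (syn_star G) (s, t) \<longleftrightarrow>
     (\<forall>f. syn G (subst lstar f (nf s)) (subst lstar f (nf t)))"
proof
  assume *: "satisfies (syn_monoid G) (syn_star G) (s, t)"
  show "\<forall>f. syn G (subst lstar f (nf s)) (subst lstar f (nf t))"
  proof
    fix f :: "nat \<Rightarrow> lit list"
    have "\<forall>i. syn_class G (f i) \<in> carrier (syn_monoid G)" by (simp add: syn_carrier)
    from *[unfolded satisfies_def fst_conv snd_conv, THEN spec, THEN mp, OF this]
    show "syn G (subst lstar f (nf s)) (subst lstar f (nf t))"
      by (simp only: eval_syn syn_class_eq_iff)
  qed
next
  assume *: "\<forall>f. syn G (subst lstar f (nf s)) (subst lstar f (nf t))"
  show "satisfies (syn_monoid G) (syn_star G) (s, t)"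
    unfolding satisfies_def fst_conv snd_conv
  proof (intro allI impI)
    fix F :: "nat \<Rightarrow> lit list set"
    assume "\<forall>i. F i \<in> carrier (syn_monoid G)"
    then have "\<exists>w. F i = syn_class G w" for i unfolding syn_carrier by blast
    then obtain f where "\<And>i. F i = syn_class G (f i)" by metis
    then have F: "F = (\<lambda>i. syn_class G (f i))" by auto
    show "eval (syn_monoid G) (syn_star G) F s = eval (syn_monoid G) (syn_star G) F t"
      unfolding F eval_syn syn_class_eq_iff using * by blast
  qed
qed

lemma subst_variables [simp]: "subst lstar (\<lambda>i. [(False, i)]) u = u"
  by (induction u) (auto simp: simg_def)

lemma not_finitely_based_styl:
  assumes n: "n \<ge> 2"
  shows "\<not> finitely_based (styl n) (styl_star n)"
proof
  assume "finitely_based (styl n) (styl_star n)"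
  then obtain E where E: "finite E" "\<And>e. e \<in> E \<Longrightarrow> satisfies (styl n) (styl_star n) e"
    "\<And>e. satisfies (styl n) (styl_star n) e \<Longrightarrow> follows_from E e"
    unfolding finitely_based_def by blast
  let ?L = "(\<lambda>e. length (nf (fst e)) + length (nf (snd e))) ` E"
  obtain N where N: "\<And>e. e \<in> E \<Longrightarrow> length (nf (fst e)) + length (nf (snd e)) < N"
    using finite_nat_set_iff_bounded[of ?L] E(1) by auto
  define s where "s = (n - 2) div 2"
  \<comment> \<open>Two more than the length bound, for the two variables that absorb a
    context.\<close>
  define K where "K = N + 2"
  \<comment> \<open>The largest index in \<open>pairs 0 (K * Suc s)\<close>.\<close>
  define k where "k = K * Suc s + 1"
  have half: "n div 2 = Suc s" using n unfolding s_def by linarith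
  have k2: "2 \<le> k" by (simp add: k_def K_def)
  let ?W = "crit s k"
  define G where "G = good n s k"
  have "satisfies (styl n) (styl_star n) (term_of ?W, term_of (lstar ?W))"
    using holds_crit[OF n] by (simp add: satisfies_styl s_def)
  then have fol: "follows_from E (term_of ?W, term_of (lstar ?W))" by (rule E(3))
  have "satisfies (syn_monoid G) (syn_star G) d" if d: "d \<in> E" for d
  proof -
    obtain t u where tu: "d = (t, u)" by (cases d)
    have h: "holds n (nf t) (nf u)" using E(2)[OF d] unfolding tu satisfies_styl .
    have len: "length (nf t) + 2 < K" "length (nf u) + 2 < K"
      using N[OF d] unfolding tu K_def by auto
    have imp: "G (a @ subst lstar f v @ b) \<longleftrightarrow> G (a @ subst lstar f w @ b)"
      if "holds n v w" "length v + 2 < K" "length w + 2 < K" for a b f v w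
      using preserve_good_context[OF half k2 that(1) _ that(2) k_def[symmetric]]
        preserve_good_context[OF half k2 holds_sym[OF that(1)] _ that(3) k_def[symmetric]]
      unfolding G_def by blast
    have "syn G (subst lstar f (nf t)) (subst lstar f (nf u))" for f
      unfolding syn_def subst_lstar_lstar[symmetric]
      using imp[OF h len] imp[OF holds_lstar[OF h]] len by simp
    then show ?thesis unfolding tu satisfies_syn by blast
  qed
  then have "satisfies (syn_monoid G) (syn_star G) (term_of ?W, term_of (lstar ?W))"
    by (rule follows_from_any[OF fol involution_monoid_syn])
  then have "\<forall>f. syn G (subst lstar f ?W) (subst lstar f (lstar ?W))"
    by (simp add: satisfies_syn)
  then have "syn G ?W (lstar ?W)" by (metis subst_variables)
  then have "G ([] @ ?W @ []) \<longleftrightarrow> G ([] @ lstar ?W @ [])" unfolding syn_def by blast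
  then show False
    using good_crit[OF half k2] not_good_lstar_crit[OF half k2] by (simp add: G_def)
qed


section \<open>Rank one\<close>

lemma styl_1_cong_iff:
  assumes "u \<in> lists {1..1}" "v \<in> lists {1..1}"
  shows "(u, v) \<in> styl_cong 1 \<longleftrightarrow> (u = [] \<longleftrightarrow> v = [])"
proof
  have *: "dec_in 1 2 1 w \<longleftrightarrow> w \<noteq> []" if "w \<in> lists {1..1}" for w
    using that by (cases w) (auto simp: dec_in_Cons)
  assume "(u, v) \<in> styl_cong 1"
  then have "dec_in 1 2 1 u \<longleftrightarrow> dec_in 1 2 1 v" by (rule styl_imp_dec_in)
  then show "u = [] \<longleftrightarrow> v = []" using * assms by blast
next
  have *: "(w, [1]) \<in> styl_cong 1" if "w \<in> lists {1..1}" "w \<noteq> []" for w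
    using that
  proof (induction w)
    case (Cons a w)
    then have a: "a = 1" "w \<in> lists {1..1}" by auto
    show ?case
    proof (cases "w = []")
      case False
      then have "(1 # w, 1 # [1]) \<in> styl_cong 1" using Cons a by (intro styl_Cons) auto
      also have "([1, 1], [1]) \<in> styl_cong 1" by (rule styl_aa) simp
      finally show ?thesis using a by simp
    qed (use a in \<open>auto intro!: styl_refl\<close>)
  qed simp
  assume e: "u = [] \<longleftrightarrow> v = []"
  show "(u, v) \<in> styl_cong 1"
  proof (cases "u = []")
    case True
    then show ?thesis using e by (auto intro: styl_refl)
  next
    case False
    then show ?thesis using *[OF assms(1)] *[OF assms(2)] e by (blast intro: styl_trans styl_sym)
  qed
qed

lemma word_star_Nil_iff: "word_star n w = [] \<longleftrightarrow> w = []"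
  by (simp add: word_star_def)

lemma subst_word_star_Nil_iff:
  "subst (word_star n) f u = [] \<longleftrightarrow> (\<forall>i\<in>snd ` set u. f i = [])"
  by (induction u) (auto simp: simg_def word_star_Nil_iff)

lemma holds_1_iff: "holds 1 u v \<longleftrightarrow> snd ` set u = snd ` set v"
proof -
  have sub: "snd ` set u \<subseteq> snd ` set v" if "holds 1 u v" for u v
  proof
    fix i assume i: "i \<in> snd ` set u"
    let ?f = "\<lambda>j. if j = i then [1] else [] :: nat list"
    have f: "\<And>j. ?f j \<in> lists {1..1}" by simp
    then have "(subst (word_star 1) ?f u, subst (word_star 1) ?f v) \<in> styl_cong 1"
      by (intro that[unfolded holds_def, THEN spec, THEN mp] allI f)
    then have "subst (word_star 1) ?f u = [] \<longleftrightarrow> subst (word_star 1) ?f v = []"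
      using styl_1_cong_iff[OF subst_lists[of ?f 1, OF f] subst_lists[of ?f 1, OF f]] by blast
    then show "i \<in> snd ` set v" using i unfolding subst_word_star_Nil_iff by (metis list.distinct(1))
  qed
  have "holds 1 u v" if "snd ` set u = snd ` set v"
    unfolding holds_def
  proof (intro allI impI)
    fix f :: "nat \<Rightarrow> nat list" assume "\<forall>i. f i \<in> lists {1..1}"
    then have f: "\<And>i. f i \<in> lists {1..1}" by blast
    show "(subst (word_star 1) f u, subst (word_star 1) f v) \<in> styl_cong 1"
      unfolding styl_1_cong_iff[OF subst_lists[of f 1, OF f] subst_lists[of f 1, OF f]]
        subst_word_star_Nil_iff that ..
  qed
  then show ?thesis using sub[of u v] sub[of v u] holds_sym by blast
qed

definition semilattice_identities :: "identity set" where
  "semilattice_identities =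
     {(Times (Var 0) (Var 0), Var 0), (Times (Var 0) (Var 1), Times (Var 1) (Var 0)), (Star (Var 0), Var 0)}"

text \<open>By idempotence and commutativity a term absorbs every term whose variables occur in it;
  terms with equal variables absorb each other and hence agree.\<close>

lemma semilattice_follows:
  assumes "snd ` set (nf t) = snd ` set (nf u)"
  shows "follows_from semilattice_identities (t, u)"
  unfolding follows_from_def
proof (intro allI impI)
  fix H :: "nat monoid" and st
  assume *: "involution_monoid H st \<and> (\<forall>d\<in>semilattice_identities. satisfies H st d)"
  then interpret involution_monoid H st by blast
  have idem: "x \<otimes>\<^bsub>H\<^esub> x = x" if "x \<in> carrier H" for x
  proof -
    have "satisfies H st (Times (Var 0) (Var 0), Var 0)" using * by (simp add: semilattice_identities_def)
    from this[unfolded satisfies_def, THEN spec[of _ "\<lambda>_. x"]] show ?thesis using that by simp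
  qed
  have comm: "x \<otimes>\<^bsub>H\<^esub> y = y \<otimes>\<^bsub>H\<^esub> x" if "x \<in> carrier H" "y \<in> carrier H" for x y
  proof -
    have "satisfies H st (Times (Var 0) (Var 1), Times (Var 1) (Var 0))"
      using * by (simp add: semilattice_identities_def)
    from this[unfolded satisfies_def, THEN spec[of _ "\<lambda>i. if i = 0 then x else y"]]
    show ?thesis using that by simp
  qed
  have star: "st x = x" if "x \<in> carrier H" for x
  proof -
    have "satisfies H st (Star (Var 0), Var 0)" using * by (simp add: semilattice_identities_def)
    from this[unfolded satisfies_def, THEN spec[of _ "\<lambda>_. x"]] show ?thesis using that by simp
  qed
  show "satisfies H st (t, u)"
    unfolding satisfies_def fst_conv snd_conv
  proof (intro allI impI)
    fix f :: "nat \<Rightarrow> nat" assume "\<forall>i. f i \<in> carrier H"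
    then have f: "\<And>i. f i \<in> carrier H" by blast
    let ?e = "eval H st f"
    have c: "?e w \<in> carrier H" for w using f by (rule eval_closed)
    have vars_Star: "snd ` set (nf (Star w)) = snd ` set (nf w)" for w
      by (simp add: image_image bar_def)
    have absorb: "i \<in> snd ` set (nf w) \<Longrightarrow> ?e w \<otimes>\<^bsub>H\<^esub> f i = ?e w" for i w
    proof (induction w)
      case (Times w1 w2)
      show ?case
      proof (cases "i \<in> snd ` set (nf w2)")
        case True
        then show ?thesis using Times.IH(2) c f by (simp add: m_assoc)
      next
        case False
        then have "?e w1 \<otimes>\<^bsub>H\<^esub> f i = ?e w1" using Times by auto
        moreover have "?e (Times w1 w2) \<otimes>\<^bsub>H\<^esub> f i = (?e w1 \<otimes>\<^bsub>H\<^esub> f i) \<otimes>\<^bsub>H\<^esub> ?e w2"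
          using c f comm[OF c[of w2] f[of i]] by (simp add: m_assoc)
        ultimately show ?thesis by simp
      qed
    next
      case (Star w)
      then show ?case unfolding vars_Star by (simp add: star[OF c])
    qed (simp_all add: idem[OF f])
    have absorb_all: "snd ` set (nf v) \<subseteq> snd ` set (nf w) \<Longrightarrow> ?e w \<otimes>\<^bsub>H\<^esub> ?e v = ?e w" for v w
    proof (induction v)
      case (Var i)
      then show ?case using absorb[of i w] by simp
    next
      case One
      then show ?case using c by simp
    next
      case (Times v1 v2)
      then have "?e w \<otimes>\<^bsub>H\<^esub> ?e v1 = ?e w" "?e w \<otimes>\<^bsub>H\<^esub> ?e v2 = ?e w" by auto
      then show ?case using c by (simp flip: m_assoc)
    next
      case (Star v)
      then show ?case unfolding vars_Star by (simp add: star[OF c])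
    qed
    have "?e t = ?e t \<otimes>\<^bsub>H\<^esub> ?e u" using assms by (intro absorb_all[symmetric]) simp
    also have "\<dots> = ?e u \<otimes>\<^bsub>H\<^esub> ?e t" by (rule comm[OF c c])
    also have "\<dots> = ?e u" using assms by (intro absorb_all) simp
    finally show "?e t = ?e u" .
  qed
qed

lemma finitely_based_styl_1: "finitely_based (styl 1) (styl_star 1)"
  unfolding finitely_based_def
proof (intro exI conjI)
  show "finite semilattice_identities" by (simp add: semilattice_identities_def)
  show "\<forall>e\<in>semilattice_identities. satisfies (styl 1) (styl_star 1) e"
    unfolding semilattice_identities_def ball_simps satisfies_styl holds_1_iff by auto
  show "\<forall>e. satisfies (styl 1) (styl_star 1) e \<longrightarrow> follows_from semilattice_identities e"
    unfolding split_paired_All satisfies_styl holds_1_iff using semilattice_follows by blast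
qed

theorem theorem5p7:
  fixes n :: nat
  assumes "n \<ge> 1"
  shows "finitely_based (styl n) (styl_star n) \<longleftrightarrow> n = 1"
proof
  assume "finitely_based (styl n) (styl_star n)"
  then have "\<not> n \<ge> 2" using not_finitely_based_styl by blast
  then show "n = 1" using assms by simp
qed (use finitely_based_styl_1 in simp)

end
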